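(* In the setting of the context, assume $K_\xi\subseteq S_2$ and that $\mathcal L(\cdot;\mathbf w)$ is $\mu$-strongly geodesically concave on $S_2$. Fix $\epsilon>0$ and set $\xi:=\epsilon L_G/2$, equivalently $\epsilon=2\xi/L_G$. Then, uniformly in $\mathbf w\in S_1$: (i) $d(V_\epsilon(\mathbf w),V^* )\le\epsilon L_G/2=\xi$; in particular $V_\epsilon(\mathbf w)\in K_\xi$, so it is feasible for the constrained inner problem $\max_{V\in K_\xi}G_{\mathbf w}(V)$. (ii) Every maximizer $V_\xi^\star(\mathbf w)$ of the constrained inner problem $\max_{V\in K_\xi}G_{\mathbf w}(V)$ satisfies $d(V_\epsilon(\mathbf w),V_\xi^\star(\mathbf w))\le(1+\sqrt2)\,\xi$. (iii) $0\le\max_{V\in K_\xi}G_{\mathbf w}(V)-G_{\mathbf w}(V_\epsilon(\mathbf w))\le2\xi^2/\epsilon=\xi L_G$.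
   Context: $\mathbb P(\boldsymbol\mu,\Lambda)$ is the Gaussian measure on $\mathbb R^n$ with mean $\boldsymbol\mu$ and covariance $\Lambda\in\mathtt{SPD}_n$ (symmetric positive definite matrices). $\mathtt{SPD}_n$ carries the Bures–Wasserstein metric $g_\Lambda(V,W)=\mathrm{tr}(L_\Lambda(V)\Lambda L_\Lambda(W))$, $L_\Lambda(U)$ the unique symmetric solution $X$ of $\Lambda X+X\Lambda=U$, with distance $d_{BW}(\Lambda_1,\Lambda_2)^2=\mathrm{tr}(\Lambda_1+\Lambda_2-2(\Lambda_1^{1/2}\Lambda_2\Lambda_1^{1/2})^{1/2})$. $\mathbb R^n\times\mathtt{SPD}_n$ carries the product metric $l_2\oplus BW$; $d$ is its distance and $\operatorname{grad}$ its Riemannian gradient. Write $V=(\boldsymbol\mu,\Lambda)$, $V^*=(\boldsymbol\mu^*,\Lambda^* )$ (fixed reference), $\psi(V):=\|\boldsymbol\mu-\boldsymbol\mu^*\|^2+d_{BW}^2(\Lambda,\Lambda^* )$, $G_{\mathbf w}(V):=\mathbb E_{\mathbf z\sim\mathbb P(\boldsymbol\mu,\Lambda)}[\ell(\mathbf w;\mathbf z)]$, $\mathcal L(V;\mathbf w):=G_{\mathbf w}(V)-\frac1\epsilon\psi(V)$. $\ell:\mathbb R^d\times\mathbb R^n\to\mathbb R$ satisfies: (A1) $\ell$ is jointly $\mathcal C^2$, non-negative and $\ell(\cdot;\mathbf z)$ is coercive for all $\mathbf z$; (A2) for some $P\ge2$, for any $\mathbf w$ and all $p\le P<\infty$ the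 $p$-th moments of $|\ell(\mathbf w;\cdot)|$, $\|\nabla_{\mathbf w}\ell(\mathbf w;\cdot)\|$, $\|\nabla^2_{\mathbf w}\ell(\mathbf w;\cdot)\|_F$ under $\mathbb P(\boldsymbol\mu^*,\Lambda^* )$ are finite. $S_1\subset\mathbb R^d$ is a compact ball. $S_2=\bar{\mathcal B}_r(\boldsymbol\mu^* )\times\bar{\mathcal B}_r(\Lambda^* )$ is the product of closed balls (Euclidean, resp. $d_{BW}$) of radius $r=(1-\gamma)\|(\Lambda^* )^{-1}\|_2^{-1/2}$, where $\gamma\in(0,1)$ satisfies $(1-\gamma)\|(\Lambda^* )^{-1}\|_2^{-1/2}<\gamma^2\pi\|(\Lambda^* )^{-1}\|_2^{-1}/\sqrt3$; $S_2$ is contained in a normal neighborhood of $V^*$. Ambiguity set of the constrained problem: $K_\xi:=\bar{\mathcal B}_\xi(\boldsymbol\mu^* )\times\{\Lambda:d_{BW}(\Lambda,\Lambda^* )\le\xi\}$. $V_\epsilon(\mathbf w)$ is the maximizer of the penalized inner problem, i.e. the maximizer of $\mathcal L(\cdot;\mathbf w)$, lying in the interior of $S_2$. $$L_G:=\sup_{\mathbf w\in S_1,\ V\in S_2}\|\operatorname{grad}_VG_{\mathbf w}(V)\|_{l_2\oplus BW}<\infty.$$ *)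

theory Defs
  imports "HOL-Analysis.Analysis"
begin

definition SPD :: "(real^'n^'n) set" where
  "SPD = {A. transpose A = A \<and> (\<forall>x. x \<noteq> 0 \<longrightarrow> 0 < x \<bullet> (A *v x))}"

definition spectral_norm :: "real^'n^'m \<Rightarrow> real" where
  "spectral_norm A = onorm ((*v) A)"

(* Only ever applied to positive definite matrices, where the positive definite root is unique. *)
definition matrix_sqrt :: "real^'n^'n \<Rightarrow> real^'n^'n" where
  "matrix_sqrt A = (THE B. B \<in> SPD \<and> B ** B = A)"

definition gaussian :: "real^'n \<Rightarrow> real^'n^'n \<Rightarrow> (real^'n) measure" where
  "gaussian \<mu> \<Lambda> = density lborel (\<lambda>z. ennreal
     (exp (- ((z - \<mu>) \<bullet> (matrix_inv \<Lambda> *v (z - \<mu>))) / 2) / sqrt ((2 * pi) ^ CARD('n) * det \<Lambda>)))"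

definition lyapunov :: "real^'n^'n \<Rightarrow> real^'n^'n \<Rightarrow> real^'n^'n" where
  "lyapunov \<Lambda> U = (THE X. transpose X = X \<and> \<Lambda> ** X + X ** \<Lambda> = U)"

definition bw_metric :: "real^'n^'n \<Rightarrow> real^'n^'n \<Rightarrow> real^'n^'n \<Rightarrow> real" where
  "bw_metric \<Lambda> V W = trace (lyapunov \<Lambda> V ** \<Lambda> ** lyapunov \<Lambda> W)"

definition bw_dist :: "real^'n^'n \<Rightarrow> real^'n^'n \<Rightarrow> real" where
  "bw_dist \<Lambda>1 \<Lambda>2 = sqrt (trace (\<Lambda>1 + \<Lambda>2
     - 2 *\<^sub>R matrix_sqrt (matrix_sqrt \<Lambda>1 ** \<Lambda>2 ** matrix_sqrt \<Lambda>1)))"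

type_synonym 'n gparam = "(real^'n) \<times> (real^'n^'n)"

(* The manifold is an open subset of the vector space R^n x Sym, which serves as its tangent
   space at every point.  It has empty interior in the ambient type, so openness, interiors and
   derivatives below are all taken relative to the manifold. *)
definition gmanifold :: "'n::finite gparam set" where
  "gmanifold = UNIV \<times> SPD"

definition gtangent :: "'n::finite gparam set" where
  "gtangent = UNIV \<times> {U. transpose U = U}"

definition gmetric :: "'n::finite gparam \<Rightarrow> 'n gparam \<Rightarrow> 'n gparam \<Rightarrow> real" where
  "gmetric V a b = fst a \<bullet> fst b + bw_metric (snd V) (snd a) (snd b)"

definition gnorm :: "'n::finite gparam \<Rightarrow> 'n gparam \<Rightarrow> real" where
  "gnorm V a = sqrt (gmetric V a a)"

definition gdist :: "'n::finite gparam \<Rightarrow> 'n gparam \<Rightarrow> real" where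
  "gdist V W = sqrt ((norm (fst V - fst W))\<^sup>2 + (bw_dist (snd V) (snd W))\<^sup>2)"

definition ggrad :: "('n::finite gparam \<Rightarrow> real) \<Rightarrow> 'n gparam \<Rightarrow> 'n gparam" where
  "ggrad F V = (THE g. g \<in> gtangent \<and>
     (\<exists>F'. (F has_derivative F') (at V within gmanifold) \<and>
           (\<forall>a\<in>gtangent. F' a = gmetric V g a)))"

definition gcball :: "'n::finite gparam \<Rightarrow> real \<Rightarrow> 'n gparam set" where
  "gcball V0 \<rho> = {V \<in> gmanifold. dist (fst V) (fst V0) \<le> \<rho> \<and> bw_dist (snd V) (snd V0) \<le> \<rho>}"

(* Riemannian geodesic segment on [0,1], parametrised with constant speed v: a curve that
   locally realises the Riemannian distance.  Its length is v. *)
definition ggeodesic :: "real \<Rightarrow> (real \<Rightarrow> 'n::finite gparam) \<Rightarrow> bool" where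
  "ggeodesic v c \<longleftrightarrow> 0 \<le> v \<and> c ` {0..1} \<subseteq> gmanifold \<and>
     (\<forall>t\<in>{0..1}. \<exists>\<delta>>0. \<forall>s\<in>{0..1} \<inter> ball t \<delta>. \<forall>s'\<in>{0..1} \<inter> ball t \<delta>.
        gdist (c s) (c s') = v * \<bar>s - s'\<bar>)"

definition strongly_geodesically_concave_on ::
    "real \<Rightarrow> ('n::finite gparam \<Rightarrow> real) \<Rightarrow> 'n gparam set \<Rightarrow> bool" where
  "strongly_geodesically_concave_on m f S \<longleftrightarrow>
     (\<forall>v c. ggeodesic v c \<and> c ` {0..1} \<subseteq> S \<longrightarrow>
        (\<forall>t\<in>{0..1}. (1 - t) * f (c 0) + t * f (c 1) + m / 2 * t * (1 - t) * v\<^sup>2 \<le> f (c t)))"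

(* Here E is the exponential map at p on the star-shaped set D (t |-> E (t v) is the geodesic
   with initial velocity v).  Exponential maps are smooth, so differentiability of the inverse
   E' makes E a diffeomorphism from D onto N. *)
definition normal_neighborhood :: "'n::finite gparam \<Rightarrow> 'n gparam set \<Rightarrow> bool" where
  "normal_neighborhood p N \<longleftrightarrow> openin (top_of_set gmanifold) N \<and>
     (\<exists>D E E'. openin (top_of_set gtangent) D \<and> 0 \<in> D \<and>
        (\<forall>a\<in>D. \<forall>t\<in>{0..1}. t *\<^sub>R a \<in> D) \<and>
        E 0 = p \<and> E ` D = N \<and> (\<forall>a\<in>D. E' (E a) = a) \<and>
        E differentiable_on D \<and> E' differentiable_on N \<and>
        (\<forall>a\<in>D. (\<exists>v. ggeodesic v (\<lambda>t. E (t *\<^sub>R a))) \<and>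
               ((\<lambda>t. E (t *\<^sub>R a)) has_vector_derivative a) (at 0 within {0..1})))"

definition C2 :: "('a::real_normed_vector \<Rightarrow> real) \<Rightarrow> bool" where
  "C2 f \<longleftrightarrow> (\<exists>(D :: 'a \<Rightarrow> 'a \<Rightarrow>\<^sub>L real) (H :: 'a \<Rightarrow> 'a \<Rightarrow>\<^sub>L ('a \<Rightarrow>\<^sub>L real)).
     (\<forall>x. (f has_derivative blinfun_apply (D x)) (at x)) \<and>
     (\<forall>x. (D has_derivative blinfun_apply (H x)) (at x)) \<and> continuous_on UNIV H)"

definition gradient :: "(real^'d \<Rightarrow> real) \<Rightarrow> real^'d \<Rightarrow> real^'d" where
  "gradient f x = (\<chi> i. frechet_derivative f (at x) (axis i 1))"

definition hessian :: "(real^'d \<Rightarrow> real) \<Rightarrow> real^'d \<Rightarrow> real^'d^'d" where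
  "hessian f x = jacobian (gradient f) (at x)"

definition assumption_A1 :: "(real^'d \<Rightarrow> real^'n \<Rightarrow> real) \<Rightarrow> bool" where
  "assumption_A1 loss \<longleftrightarrow> C2 (\<lambda>(w, z). loss w z) \<and> (\<forall>w z. 0 \<le> loss w z) \<and>
     (\<forall>z. filterlim (\<lambda>w. loss w z) at_top at_infinity)"

(* The norm of the type real^'d^'d is the Frobenius norm. *)
definition assumption_A2 :: "(real^'d \<Rightarrow> real^'n \<Rightarrow> real) \<Rightarrow> 'n::finite gparam \<Rightarrow> bool" where
  "assumption_A2 loss Vs \<longleftrightarrow> (\<exists>P::real. 2 \<le> P \<and> (\<forall>w p. 0 < p \<and> p \<le> P \<longrightarrow>
     integrable (gaussian (fst Vs) (snd Vs)) (\<lambda>z. \<bar>loss w z\<bar> powr p) \<and>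
     integrable (gaussian (fst Vs) (snd Vs)) (\<lambda>z. norm (gradient (\<lambda>u. loss u z) w) powr p) \<and>
     integrable (gaussian (fst Vs) (snd Vs)) (\<lambda>z. norm (hessian (\<lambda>u. loss u z) w) powr p)))"

definition G :: "(real^'d \<Rightarrow> real^'n \<Rightarrow> real) \<Rightarrow> real^'d \<Rightarrow> 'n::finite gparam \<Rightarrow> real" where
  "G loss w V = integral\<^sup>L (gaussian (fst V) (snd V)) (loss w)"

definition \<psi> :: "'n::finite gparam \<Rightarrow> 'n gparam \<Rightarrow> real" where
  "\<psi> Vs V = (norm (fst V - fst Vs))\<^sup>2 + (bw_dist (snd V) (snd Vs))\<^sup>2"

definition penalized ::
    "(real^'d \<Rightarrow> real^'n \<Rightarrow> real) \<Rightarrow> 'n::finite gparam \<Rightarrow> real \<Rightarrow> real^'d \<Rightarrow> 'n gparam \<Rightarrow> real" where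
  "penalized loss Vs \<epsilon> w V = G loss w V - 1 / \<epsilon> * \<psi> Vs V"

definition G_grad_norms ::
    "(real^'d \<Rightarrow> real^'n \<Rightarrow> real) \<Rightarrow> (real^'d) set \<Rightarrow> 'n::finite gparam set \<Rightarrow> real set" where
  "G_grad_norms loss S1 S2 = (\<lambda>(w, V). gnorm V (ggrad (G loss w) V)) ` (S1 \<times> S2)"

end

theory Submission
  imports Defs
begin

text \<open>
  The Bures--Wasserstein distance is the Procrustes distance between matrix factors:
  \<open>bw_dist A B\<close> is the minimum of \<open>norm (X - Y)\<close> over \<open>Y\<close> with \<open>Y ** transpose Y = B\<close>, for any
  fixed \<open>X\<close> with \<open>X ** transpose X = A\<close>. This gives symmetry, the triangle inequality and
  compactness of the balls whose factors stay invertible.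

  For (i), walk from \<open>V\<epsilon>\<close> towards \<open>Vs\<close> along the explicit geodesic. With \<open>d\<close> the distance, the
  penalty is at most \<open>(1 - t)\<^sup>2 d\<^sup>2 / \<epsilon>\<close>, while \<open>G\<close> changes with slope at least \<open>- L\<^sub>G d\<close> at \<open>t = 0\<close>, so
  maximality forces \<open>2 d\<^sup>2 / \<epsilon> \<le> L\<^sub>G d\<close>. Every point of \<open>K\<close> has distance at most \<open>sqrt 2 * \<xi>\<close> from
  \<open>Vs\<close>, so (ii) is the triangle inequality, and (iii) compares the penalized values at \<open>V\<epsilon>\<close> and at
  a maximizer over \<open>K\<close>, where the penalty is at most \<open>2 \<xi>\<^sup>2 / \<epsilon>\<close>.
\<close>

subsection \<open>Matrices as an inner product space\<close>

text \<open>Source of the difference, scaling, continuity and product derivative rules for matrix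
  products.\<close>

lemma bounded_bilinear_matrix_mul:
  "bounded_bilinear ((**) :: real^'m^'k \<Rightarrow> real^'n^'m \<Rightarrow> real^'n^'k)"
  unfolding bilinear_conv_bounded_bilinear[symmetric] bilinear_def
  by (auto intro!: linearI simp: matrix_add_ldistrib matrix_scalar_ac scalar_matrix_assoc
      matrix_matrix_mult_def vec_eq_iff algebra_simps sum.distrib sum_distrib_left)

lemmas matrix_mul_diff_left = bounded_bilinear.diff_left[OF bounded_bilinear_matrix_mul]
  and matrix_mul_diff_right = bounded_bilinear.diff_right[OF bounded_bilinear_matrix_mul]
  and matrix_mul_add_left = bounded_bilinear.add_left[OF bounded_bilinear_matrix_mul]
  and matrix_mul_scaleR_left = bounded_bilinear.scaleR_left[OF bounded_bilinear_matrix_mul]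
  and matrix_mul_scaleR_right = bounded_bilinear.scaleR_right[OF bounded_bilinear_matrix_mul]

lemmas matrix_mul_distribs = matrix_mul_diff_left matrix_mul_diff_right matrix_mul_add_left
  matrix_add_ldistrib matrix_mul_scaleR_left matrix_mul_scaleR_right

lemmas continuous_on_matrix_mul [continuous_intros] =
  bounded_bilinear.continuous_on[OF bounded_bilinear_matrix_mul]

lemma linear_transpose: "linear (transpose :: real^'n^'m \<Rightarrow> real^'m^'n)"
  by (auto intro!: linearI simp: transpose_def vec_eq_iff)

lemmas transpose_add = linear_add[OF linear_transpose]
  and transpose_diff = linear_diff[OF linear_transpose]

lemma continuous_on_transpose [continuous_intros]:
  fixes f :: "'a::topological_space \<Rightarrow> real^'n^'m"
  shows "continuous_on S f \<Longrightarrow> continuous_on S (\<lambda>x. transpose (f x))"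
  by (rule bounded_linear.continuous_on[OF linear_transpose[unfolded linear_conv_bounded_linear]])

lemma inner_matrix_trace:
  fixes A B :: "real^'n^'m"
  shows "A \<bullet> B = trace (A ** transpose B)"
  by (simp add: inner_vec_def trace_def matrix_matrix_mult_def transpose_def)

lemma trace_inner_mat1:
  fixes A :: "real^'n^'n"
  shows "trace A = A \<bullet> mat 1"
  by (simp add: inner_matrix_trace)

lemma inner_matrix_mul_left:
  fixes A :: "real^'m^'k" and B :: "real^'n^'m"
  shows "(A ** B) \<bullet> C = B \<bullet> (transpose A ** C)"
  by (simp add: inner_matrix_trace matrix_transpose_mul matrix_mul_assoc)
     (metis matrix_mul_assoc trace_mul_sym)

lemma inner_matrix_mul_right:
  fixes A :: "real^'m^'k" and B :: "real^'n^'m"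
  shows "(A ** B) \<bullet> C = A \<bullet> (C ** transpose B)"
  by (simp add: inner_matrix_trace matrix_transpose_mul matrix_mul_assoc)

lemma inner_transpose:
  fixes A B :: "real^'n^'m"
  shows "transpose A \<bullet> transpose B = A \<bullet> B"
  unfolding inner_vec_def transpose_def by (simp, rule sum.swap)

lemma norm_transpose:
  fixes A :: "real^'n^'m"
  shows "norm (transpose A) = norm A"
  by (simp add: norm_eq_sqrt_inner inner_transpose)

text \<open>Together with \<open>column_matrix_mul\<close> this reduces estimates for
  \<open>A ** B\<close> to estimates for \<open>A\<close> acting on each column of
  \<open>B\<close>.\<close>

lemma inner_columns:
  fixes A B :: "real^'n^'m"
  shows "A \<bullet> B = (\<Sum>j\<in>UNIV. column j A \<bullet> column j B)"
  by (simp add: inner_vec_def column_def) (rule sum.swap)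

lemma column_matrix_mul: "column j (A ** B) = A *v column j B"
  by (simp add: column_def matrix_matrix_mult_def matrix_vector_mult_def)

text \<open>An operator norm bound on \<open>A\<close> applies to every column of \<open>B\<close>;
  summing the squares gives the Frobenius bound. This yields the contraction constant in the square
  root construction.\<close>

lemma norm_matrix_mul_le:
  fixes A :: "real^'m^'k" and B :: "real^'n^'m"
  assumes "\<And>x. norm (A *v x) \<le> q * norm x" "0 \<le> q"
  shows "norm (A ** B) \<le> q * norm B"
proof -
  have "(A ** B) \<bullet> (A ** B) \<le> (\<Sum>j\<in>UNIV. q\<^sup>2 * (column j B \<bullet> column j B))"
    unfolding inner_columns[of "A ** B"] column_matrix_mul
    by (intro sum_mono) (metis assms(1) norm_ge_zero power2_norm_eq_inner power_mono power_mult_distrib)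
  also have "\<dots> = (q * norm B)\<^sup>2"
    by (simp add: inner_columns[of B] power_mult_distrib power2_norm_eq_inner sum_distrib_left)
  finally show ?thesis
    using assms(2) by (metis mult_nonneg_nonneg norm_ge_zero power2_le_imp_le power2_norm_eq_inner)
qed

lemma norm_matrix_vector_mul_le:
  fixes A :: "real^'n^'m"
  shows "norm (A *v x) \<le> norm A * norm x"
proof -
  have "(A *v x) = (\<chi> i. A $ i \<bullet> x)"
    by (rule matrix_mult_dot)
  then have "norm (A *v x) \<le> L2_set (\<lambda>i. norm (A $ i) * norm x) UNIV"
    by (auto simp: norm_vec_def[of "\<chi> i. A $ i \<bullet> x"] Cauchy_Schwarz_ineq2 intro!: L2_set_mono)
  also have "\<dots> = norm A * norm x"
    by (simp add: L2_set_left_distrib norm_vec_def[of A])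
  finally show ?thesis .
qed

lemma transpose_symmetric_inner:
  fixes A :: "real^'n^'n"
  assumes "transpose A = A"
  shows "x \<bullet> (A *v y) = (A *v x) \<bullet> y"
  by (metis assms dot_lmul_matrix transpose_matrix_vector)

lemma matrix_inv_mul:
  fixes A :: "real^'n^'n"
  assumes "invertible A"
  shows "A ** matrix_inv A = mat 1" "matrix_inv A ** A = mat 1"
  using someI_ex[OF assms[unfolded invertible_def]] by (simp_all add: matrix_inv_def)

subsection \<open>Positive definite matrices and their square roots\<close>

lemma SPD_transpose: "A \<in> SPD \<Longrightarrow> transpose A = A"
  by (simp add: SPD_def)

lemma SPD_pos: "A \<in> SPD \<Longrightarrow> x \<noteq> 0 \<Longrightarrow> 0 < x \<bullet> (A *v x)"
  by (simp add: SPD_def)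

lemma SPD_nonneg: "A \<in> SPD \<Longrightarrow> 0 \<le> x \<bullet> (A *v x)"
  by (cases "x = 0") (auto simp: SPD_def less_imp_le)

lemma SPD_invertible:
  assumes "A \<in> SPD" shows "invertible A"
  unfolding invertible_left_inverse matrix_left_invertible_ker
  by (metis SPD_pos assms inner_zero_right less_irrefl)

text \<open>The quadratic form at \<open>x\<close> is that of \<open>A\<close> at
  \<open>transpose M *v x\<close>, which is nonzero when \<open>x\<close> is, because
  \<open>transpose M\<close> is injective.\<close>

lemma SPD_congruence:
  fixes A M :: "real^'n^'n"
  assumes "A \<in> SPD" "invertible M"
  shows "M ** A ** transpose M \<in> SPD"
proof -
  have "transpose M *v x \<noteq> 0" if "x \<noteq> 0" for x
    using that assms(2) transpose_invertible[of M]
    unfolding invertible_left_inverse matrix_left_invertible_ker by blast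
  moreover have "x \<bullet> ((M ** A ** transpose M) *v x) = (transpose M *v x) \<bullet> (A *v (transpose M *v x))" for x
    by (simp add: matrix_vector_mul_assoc[symmetric] dot_lmul_matrix del: transpose_matrix_vector)
       (simp add: dot_lmul_matrix)
  ultimately show ?thesis
    using assms(1) by (simp add: SPD_def matrix_transpose_mul matrix_mul_assoc)
qed

lemma SPD_mat1: "mat 1 \<in> SPD"
  by (simp add: SPD_def)

lemma SPD_mul_transpose: "invertible (X :: real^'n^'n) \<Longrightarrow> X ** transpose X \<in> SPD"
  using SPD_congruence[OF SPD_mat1, of X] by simp

text \<open>Once the inverse is known to be symmetric, it is the congruence of \<open>A\<close> by
  itself: \<open>I ** A ** I = I\<close> for \<open>I = matrix_inv A\<close>.\<close>

lemma SPD_inv: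
  assumes "A \<in> SPD" shows "matrix_inv A \<in> SPD"
proof -
  note inv = matrix_inv_mul[OF SPD_invertible[OF assms]]
  have "transpose (matrix_inv A) ** A = mat 1"
    by (metis SPD_transpose assms inv(1) matrix_transpose_mul transpose_mat)
  then have sym: "transpose (matrix_inv A) = matrix_inv A"
    by (metis inv(1) matrix_mul_assoc matrix_mul_lid matrix_mul_rid)
  have "invertible (matrix_inv A)"
    using inv by (auto simp: invertible_def)
  from SPD_congruence[OF assms this] show ?thesis
    by (simp add: sym inv)
qed

lemma SPD_convex:
  assumes "A \<in> SPD" "B \<in> SPD" "0 \<le> t" "t \<le> 1"
  shows "(1 - t) *\<^sub>R A + t *\<^sub>R B \<in> SPD"
proof -
  have "0 < x \<bullet> (((1 - t) *\<^sub>R A + t *\<^sub>R B) *v x)" if "x \<noteq> 0" for x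
  proof -
    have "0 < (1 - t) * (x \<bullet> (A *v x)) + t * (x \<bullet> (B *v x))"
      using SPD_pos[OF assms(1) that] SPD_pos[OF assms(2) that] assms(3,4)
      by (cases "t = 0") (auto intro!: add_nonneg_pos)
    then show ?thesis
      by (simp add: matrix_vector_mult_add_rdistrib scaleR_matrix_vector_assoc[symmetric] inner_add_right)
  qed
  then show ?thesis
    using assms by (simp add: SPD_def transpose_add transpose_scalar)
qed

text \<open>The constant is the minimum of the quadratic form on the unit sphere, attained by
  compactness and extended to all vectors by homogeneity.\<close>

lemma SPD_lower_bound:
  fixes A :: "real^'n^'n"
  assumes "A \<in> SPD"
  shows "\<exists>l>0. \<forall>x. l * (x \<bullet> x) \<le> x \<bullet> (A *v x)"
proof -
  have "continuous_on (sphere 0 1) (\<lambda>x. x \<bullet> (A *v x))"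
    by (intro continuous_intros)
  moreover have "sphere (0 :: real^'n) 1 \<noteq> {}"
    by simp
  ultimately obtain u where u: "u \<in> sphere 0 1" "\<forall>y\<in>sphere 0 1. u \<bullet> (A *v u) \<le> y \<bullet> (A *v y)"
    using continuous_attains_inf[OF compact_sphere, of "0 :: real^'n" 1 "\<lambda>x. x \<bullet> (A *v x)"] by blast
  have "(u \<bullet> (A *v u)) * (x \<bullet> x) \<le> x \<bullet> (A *v x)" for x
  proof (cases "x = 0")
    case False
    have "u \<bullet> (A *v u) \<le> (x /\<^sub>R norm x) \<bullet> (A *v (x /\<^sub>R norm x))"
      using False by (intro u(2)[rule_format]) simp
    also have "\<dots> = (x \<bullet> (A *v x)) / (x \<bullet> x)"
      using False by (simp add: matrix_vector_mult_scaleR dot_square_norm power2_eq_square divide_simps)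
    finally show ?thesis
      using False by (simp add: pos_le_divide_eq)
  qed simp
  moreover have "0 < u \<bullet> (A *v u)"
    using u(1) by (intro SPD_pos[OF assms]) auto
  ultimately show ?thesis by blast
qed

text \<open>Both \<open>X \<bullet> (B ** X)\<close> and \<open>X \<bullet> (X ** D)\<close> are nonnegative, and here they add up to zero.\<close>

lemma SPD_sylvester_zero:
  fixes X :: "real^'n^'n"
  assumes "B \<in> SPD" "D \<in> SPD" "B ** X + X ** D = 0"
  shows "X = 0"
proof -
  have pos: "0 \<le> Y \<bullet> (A ** Y)" if "A \<in> SPD" for A Y :: "real^'n^'n"
    by (simp add: inner_columns[of Y] column_matrix_mul SPD_nonneg[OF that] sum_nonneg)
  have "X \<bullet> (X ** D) = transpose X \<bullet> (D ** transpose X)"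
    by (metis SPD_transpose assms(2) inner_transpose matrix_transpose_mul)
  then have "0 \<le> X \<bullet> (X ** D)"
    using pos[OF assms(2)] by simp
  moreover have "X \<bullet> (B ** X) + X \<bullet> (X ** D) = 0"
    by (metis assms(3) inner_add_right inner_zero_right)
  ultimately have "X \<bullet> (B ** X) = 0"
    using pos[OF assms(1), of X] by linarith
  then have "(\<Sum>j\<in>UNIV. column j X \<bullet> (B *v column j X)) = 0"
    by (simp add: inner_columns[of X] column_matrix_mul)
  then have "column j X \<bullet> (B *v column j X) = 0" for j
    by (simp add: sum_nonneg_eq_0_iff SPD_nonneg[OF assms(1)])
  then have "column j X = 0" for j
    by (metis SPD_pos assms(1) less_irrefl)
  then show ?thesis
    by (simp add: column_def vec_eq_iff)
qed

text \<open>Write \<open>A = c (1 - C)\<close> with \<open>C\<close> of operator norm \<open>q < 1\<close>. A fixed point \<open>Y\<close> of the contraction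
  \<open>Y \<mapsto> (C + Y\<^sup>2) / 2\<close> satisfies \<open>(1 - Y)\<^sup>2 = 1 - C\<close>.\<close>

lemma SPD_sqrt_exists:
  fixes A :: "real^'n^'n"
  assumes "A \<in> SPD"
  shows "\<exists>B. B \<in> SPD \<and> B ** B = A"
proof -
  obtain l where l: "0 < l" "\<And>x. l * (x \<bullet> x) \<le> x \<bullet> (A *v x)"
    using SPD_lower_bound[OF assms] by metis
  \<comment> \<open>\<open>M\<close> dominates both the operator norm of \<open>A\<close> and
    \<open>l\<close>. The choice \<open>c = M\<^sup>2 / l\<close> below minimizes the bound
    \<open>1 - 2 * l / c + M\<^sup>2 / c\<^sup>2\<close> for the squared operator norm of
    \<open>C\<close>; the minimum is \<open>q\<^sup>2 = 1 - l\<^sup>2 / M\<^sup>2\<close>.\<close>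
  define M where "M = norm A + l"
  have M: "0 < M" "l \<le> M"
    using l(1) by (simp_all add: M_def add_nonneg_pos)
  have AM: "norm (A *v x) \<le> M * norm x" for x
  proof -
    have "norm A * norm x \<le> M * norm x"
      using l(1) by (intro mult_right_mono) (simp_all add: M_def)
    with norm_matrix_vector_mul_le[of A x] show ?thesis by linarith
  qed
  define c where "c = M\<^sup>2 / l"
  have c: "0 < c" using l M by (simp add: c_def)
  define C where "C = mat 1 - (1/c) *\<^sub>R A"
  define q where "q = sqrt (1 - l\<^sup>2 / M\<^sup>2)"
  have lM: "l\<^sup>2 / M\<^sup>2 \<le> 1" "0 < l\<^sup>2 / M\<^sup>2"
    using l(1) M power_mono[of l M 2] by simp_all
  then have q: "0 \<le> q" "q < 1" by (simp_all add: q_def)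
  have Cq: "norm (C *v x) \<le> q * norm x" for x
  proof -
    have "(C *v x) \<bullet> (C *v x) = x \<bullet> x - 2 / c * (x \<bullet> (A *v x)) + (norm (A *v x))\<^sup>2 / c\<^sup>2"
      by (simp add: C_def matrix_vector_mult_diff_rdistrib scaleR_matrix_vector_assoc[symmetric]
          inner_diff_left inner_diff_right power2_norm_eq_inner inner_commute[of "A *v x" x]
          power2_eq_square[of c] diff_divide_distrib)
    also have "\<dots> \<le> x \<bullet> x - 2 / c * (l * (x \<bullet> x)) + (M * norm x)\<^sup>2 / c\<^sup>2"
    proof -
      have "2 / c * (l * (x \<bullet> x)) \<le> 2 / c * (x \<bullet> (A *v x))"
        using l(2)[of x] c by (intro mult_left_mono) auto
      moreover have "(norm (A *v x))\<^sup>2 / c\<^sup>2 \<le> (M * norm x)\<^sup>2 / c\<^sup>2"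
        using AM[of x] by (intro divide_right_mono power_mono) auto
      ultimately show ?thesis by linarith
    qed
    also have "\<dots> = (1 - l\<^sup>2 / M\<^sup>2) * (x \<bullet> x)"
      using l M by (simp add: c_def power2_norm_eq_inner[symmetric] field_simps power2_eq_square)
    also have "\<dots> = (q * norm x)\<^sup>2"
      using lM by (simp add: q_def power_mult_distrib power2_norm_eq_inner)
    finally show ?thesis
      using q by (metis mult_nonneg_nonneg norm_ge_zero power2_le_imp_le power2_norm_eq_inner)
  qed
  define S :: "(real^'n^'n) set" where "S = {Y. transpose Y = Y \<and> (\<forall>x. norm (Y *v x) \<le> q * norm x)}"
  define f where "f Y = (1/2) *\<^sub>R (C + Y ** Y)" for Y
  have lin: "linear (\<lambda>Y :: real^'n^'n. Y *v x)" for x :: "real^'n"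
    by (auto intro!: linearI simp: matrix_vector_mult_add_rdistrib scaleR_matrix_vector_assoc)
  have "closed S"
    unfolding S_def
    by (intro closed_Collect_conj closed_Collect_eq closed_Collect_all closed_Collect_le
        continuous_intros linear_continuous_on_compose[OF _ lin])
  then have "complete S" by (simp add: complete_eq_closed)
  moreover have "0 \<in> S" using q by (auto simp: S_def transpose_def vec_eq_iff)
  \<comment> \<open>Invariance comes from \<open>(q + q * q) / 2 \<le> q\<close>, and symmetry is
    preserved since \<open>C\<close> is symmetric.\<close>
  moreover have "f Y \<in> S" if "Y \<in> S" for Y
  proof -
    have "norm (f Y *v x) \<le> q * norm x" for x
    proof -
      have "norm (Y *v (Y *v x)) \<le> q * norm (Y *v x)" using that by (simp add: S_def)
      also have "\<dots> \<le> q * (q * norm x)" using that q by (intro mult_left_mono) (simp_all add: S_def)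
      also have "\<dots> \<le> 1 * (q * norm x)" using q by (intro mult_right_mono) auto
      finally have "norm (Y *v (Y *v x)) \<le> q * norm x" by simp
      then have "norm (C *v x + Y *v (Y *v x)) \<le> 2 * (q * norm x)"
        using Cq[of x] norm_triangle_ineq[of "C *v x" "Y *v (Y *v x)"] by linarith
      then show ?thesis
        by (simp add: f_def scaleR_matrix_vector_assoc[symmetric] matrix_vector_mult_add_rdistrib matrix_vector_mul_assoc)
    qed
    moreover have "transpose (f Y) = f Y"
      using that assms
      by (simp add: f_def S_def C_def transpose_scalar transpose_add transpose_diff matrix_transpose_mul SPD_transpose)
    ultimately show ?thesis by (simp add: S_def)
  qed
  moreover have "dist (f Y) (f Z) \<le> q * dist Y Z" if "Y \<in> S" "Z \<in> S" for Y Z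
  proof -
    have "norm (Y ** (Y - Z)) \<le> q * norm (Y - Z)"
      using that q by (intro norm_matrix_mul_le) (auto simp: S_def)
    \<comment> \<open>The column estimate handles left factors only, so the product is transposed
      first. The splitting of \<open>Y ** Y - Z ** Z\<close> below respects that \<open>Y\<close>
      and \<open>Z\<close> may not commute.\<close>
    moreover have "norm ((Y - Z) ** Z) = norm (Z ** transpose (Y - Z))"
      using that(2) norm_transpose[of "(Y - Z) ** Z"] by (simp add: S_def matrix_transpose_mul)
    moreover have "\<dots> \<le> q * norm (transpose (Y - Z))"
      using that q by (intro norm_matrix_mul_le) (auto simp: S_def)
    moreover have "f Y - f Z = (1/2) *\<^sub>R (Y ** (Y - Z) + (Y - Z) ** Z)"
      by (simp add: f_def matrix_mul_distribs algebra_simps)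
    ultimately show ?thesis
      using norm_triangle_ineq[of "Y ** (Y - Z)" "(Y - Z) ** Z"] by (simp add: dist_norm norm_transpose)
  qed
  ultimately obtain Y where Y: "Y \<in> S" "f Y = Y"
    using Banach_fix[of S q f] q by blast
  define B where "B = sqrt c *\<^sub>R (mat 1 - Y)"
  have "Y + Y = C + Y ** Y"
    using arg_cong[OF Y(2), of "\<lambda>Z. 2 *\<^sub>R Z"] by (simp add: f_def scaleR_2)
  then have "(mat 1 - Y) ** (mat 1 - Y) = mat 1 - C"
    by (simp add: matrix_mul_distribs algebra_simps)
  then have "B ** B = A"
    using c by (simp add: B_def C_def matrix_mul_scaleR_left matrix_mul_scaleR_right)
  moreover have "B \<in> SPD"
  proof -
    have "0 < x \<bullet> (B *v x)" if "x \<noteq> 0" for x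
    proof -
      have "x \<bullet> (Y *v x) \<le> norm x * (q * norm x)"
        using Y(1) by (intro order.trans[OF norm_cauchy_schwarz] mult_left_mono) (auto simp: S_def)
      also have "\<dots> < norm x * (1 * norm x)"
        using q that by (intro mult_strict_left_mono mult_strict_right_mono) auto
      also have "\<dots> = x \<bullet> x" by (simp add: dot_square_norm power2_eq_square)
      finally show ?thesis
        using c by (simp add: B_def scaleR_matrix_vector_assoc[symmetric] matrix_vector_mult_diff_rdistrib inner_diff_right)
    qed
    then show ?thesis
      using Y(1) by (simp add: SPD_def S_def B_def transpose_scalar transpose_diff)
  qed
  ultimately show ?thesis by blast
qed

text \<open>\<open>B ** (B - D) + (B - D) ** D\<close> telescopes to
  \<open>B ** B - D ** D = 0\<close>, so the Sylvester equation forces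
  \<open>B - D = 0\<close>.\<close>

lemma SPD_sqrt_unique:
  assumes "B \<in> SPD" "D \<in> SPD" "B ** B = D ** D"
  shows "B = D"
  using SPD_sylvester_zero[OF assms(1,2), of "B - D"] assms(3)
  by (simp add: matrix_mul_distribs)

lemma matrix_sqrt_eq: "B \<in> SPD \<Longrightarrow> B ** B = A \<Longrightarrow> matrix_sqrt A = B"
  unfolding matrix_sqrt_def by (rule the_equality) (auto intro: SPD_sqrt_unique)

lemma
  assumes "A \<in> SPD"
  shows SPD_matrix_sqrt: "matrix_sqrt A \<in> SPD"
    and matrix_sqrt_mul_self: "matrix_sqrt A ** matrix_sqrt A = A"
proof -
  obtain B where "B \<in> SPD" "B ** B = A"
    using SPD_sqrt_exists[OF assms] by blast
  then show "matrix_sqrt A \<in> SPD" "matrix_sqrt A ** matrix_sqrt A = A"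
    by (simp_all add: matrix_sqrt_eq)
qed

subsection \<open>Optimal transport description of the Bures--Wasserstein distance\<close>

text \<open>The witness is the optimal transport map between centred Gaussians,
  \<open>T = A^(-1/2) (A^(1/2) B A^(1/2))^(1/2) A^(-1/2)\<close>, with \<open>S = A^(1/2)\<close>,
  \<open>I\<close> its inverse and \<open>R\<close> the middle root.\<close>

lemma transport_exists:
  fixes A B :: "real^'n^'n"
  assumes A: "A \<in> SPD" and B: "B \<in> SPD"
  shows "\<exists>T\<in>SPD. T ** A ** T = B"
proof -
  define S where "S = matrix_sqrt A"
  have S: "S \<in> SPD" "S ** S = A"
    using A by (simp_all add: S_def SPD_matrix_sqrt matrix_sqrt_mul_self)
  define I where "I = matrix_inv S"
  have I: "I \<in> SPD" "S ** I = mat 1" "I ** S = mat 1"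
    using S(1) by (simp_all add: I_def SPD_inv matrix_inv_mul SPD_invertible)
  have "S ** B ** S \<in> SPD"
    using SPD_congruence[OF B SPD_invertible[OF S(1)]] by (simp add: SPD_transpose[OF S(1)])
  then obtain R where R: "R \<in> SPD" "R ** R = S ** B ** S"
    using SPD_sqrt_exists by blast
  have "I ** R ** I \<in> SPD"
    using SPD_congruence[OF R(1) SPD_invertible[OF I(1)]] by (simp add: SPD_transpose[OF I(1)])
  moreover have "(I ** R ** I) ** A ** (I ** R ** I) = I ** R ** (I ** S) ** (S ** I) ** R ** I"
    by (simp add: S(2)[symmetric] matrix_mul_assoc)
  then have "(I ** R ** I) ** A ** (I ** R ** I) = I ** (R ** R) ** I"
    by (simp only: I matrix_mul_rid matrix_mul_assoc)
  then have "(I ** R ** I) ** A ** (I ** R ** I) = (I ** S) ** B ** (S ** I)"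
    by (simp add: R(2) matrix_mul_assoc)
  then have "(I ** R ** I) ** A ** (I ** R ** I) = B"
    by (simp add: I)
  ultimately show ?thesis by blast
qed

text \<open>The transport map makes the nested root explicit: it is \<open>S ** T ** S\<close> with
  \<open>S = matrix_sqrt A\<close>, whose trace is that of \<open>T ** A\<close>. Leaving the factor
  \<open>X\<close> arbitrary is what later allows optimal factors to be chained.\<close>

lemma bw_dist_transport:
  fixes A T X :: "real^'n^'n"
  assumes A: "A \<in> SPD" and T: "T \<in> SPD" and X: "X ** transpose X = A"
  shows "bw_dist A (T ** A ** T) = norm (X - T ** X)"
proof -
  define S where "S = matrix_sqrt A"
  have S: "S \<in> SPD" "S ** S = A"
    using A by (simp_all add: S_def SPD_matrix_sqrt matrix_sqrt_mul_self)
  have "S ** T ** S \<in> SPD"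
    using SPD_congruence[OF T SPD_invertible[OF S(1)]] by (simp add: SPD_transpose[OF S(1)])
  moreover have "(S ** T ** S) ** (S ** T ** S) = S ** (T ** A ** T) ** S"
    by (simp add: S(2)[symmetric] matrix_mul_assoc)
  ultimately have root: "matrix_sqrt (S ** (T ** A ** T) ** S) = S ** T ** S"
    by (rule matrix_sqrt_eq)
  have "trace A = X \<bullet> X"
    by (simp add: inner_matrix_trace X)
  moreover have "trace (T ** A ** T) = (T ** X) \<bullet> (T ** X)"
    by (simp add: inner_matrix_trace X[symmetric] matrix_transpose_mul SPD_transpose[OF T] matrix_mul_assoc)
  moreover have "trace (S ** T ** S) = trace (T ** A)"
    using trace_mul_sym[of S "T ** S"] by (simp add: matrix_mul_assoc[symmetric] S(2))
  moreover have "trace (T ** A) = (T ** X) \<bullet> X"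
    by (simp add: inner_matrix_trace X[symmetric] matrix_mul_assoc)
  moreover have "trace (2 *\<^sub>R (S ** T ** S)) = 2 * trace (S ** T ** S)"
    by (simp add: trace_inner_mat1)
  ultimately have "trace (A + T ** A ** T - 2 *\<^sub>R (S ** T ** S)) = (X - T ** X) \<bullet> (X - T ** X)"
    by (simp add: trace_add trace_sub inner_diff_left inner_diff_right inner_commute)
  then show ?thesis
    by (simp add: bw_dist_def S_def[symmetric] root norm_eq_sqrt_inner)
qed

lemma bw_dist_attained:
  fixes A B X :: "real^'n^'n"
  assumes "A \<in> SPD" "B \<in> SPD" "X ** transpose X = A"
  shows "\<exists>Y. Y ** transpose Y = B \<and> bw_dist A B = norm (X - Y)"
proof -
  obtain T where T: "T \<in> SPD" "T ** A ** T = B"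
    using transport_exists[OF assms(1,2)] by blast
  have "(T ** X) ** transpose (T ** X) = B"
    by (simp add: matrix_transpose_mul SPD_transpose[OF T(1)] T(2)[symmetric] assms(3)[symmetric] matrix_mul_assoc)
  then show ?thesis
    using bw_dist_transport[OF assms(1) T(1) assms(3)] T(2) by (intro exI[of _ "T ** X"]) simp
qed

text \<open>If \<open>T\<close> transports \<open>A\<close> to \<open>B\<close>, the claim reduces to
  \<open>X \<bullet> Y = (T^(1/2) X) \<bullet> (T^(-1/2) Y) \<le> X \<bullet> (T X)\<close>, which is Cauchy--Schwarz since both factors have
  the same norm.\<close>

lemma bw_dist_le_norm:
  fixes X Y :: "real^'n^'n"
  assumes A: "X ** transpose X \<in> SPD" and B: "Y ** transpose Y \<in> SPD"
  shows "bw_dist (X ** transpose X) (Y ** transpose Y) \<le> norm (X - Y)"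
proof -
  define A where "A = X ** transpose X"
  obtain T where T: "T \<in> SPD" "T ** A ** T = Y ** transpose Y"
    using transport_exists[OF A B] by (auto simp: A_def)
  define S where "S = matrix_sqrt T"
  have S: "S \<in> SPD" "S ** S = T"
    using T by (simp_all add: S_def SPD_matrix_sqrt matrix_sqrt_mul_self)
  define I where "I = matrix_inv S"
  have I: "I \<in> SPD" "S ** I = mat 1" "I ** S = mat 1"
    using S(1) by (simp_all add: I_def SPD_inv matrix_inv_mul SPD_invertible)
  note sym = SPD_transpose[OF S(1)] SPD_transpose[OF I(1)] SPD_transpose[OF T(1)]
  have "(I ** Y) \<bullet> (I ** Y) = trace (I ** (Y ** transpose Y) ** I)"
    by (simp add: inner_matrix_trace matrix_transpose_mul sym matrix_mul_assoc)
  also have "I ** (Y ** transpose Y) ** I = (I ** S) ** S ** A ** S ** (S ** I)"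
    by (simp add: T(2)[symmetric] S(2)[symmetric] matrix_mul_assoc)
  also have "trace \<dots> = (S ** X) \<bullet> (S ** X)"
    by (simp add: I A_def inner_matrix_trace matrix_transpose_mul sym matrix_mul_assoc)
  finally have norms: "norm (I ** Y) = norm (S ** X)"
    by (simp add: norm_eq_sqrt_inner)
  have "(S ** X) \<bullet> (I ** Y) = X \<bullet> Y"
    by (simp add: inner_matrix_mul_left sym matrix_mul_assoc I)
  then have "X \<bullet> Y \<le> (S ** X) \<bullet> (S ** X)"
    using norm_cauchy_schwarz[of "S ** X" "I ** Y"] by (simp add: norms dot_square_norm power2_eq_square)
  also have "(S ** X) \<bullet> (S ** X) = X \<bullet> (T ** X)"
    by (simp add: inner_matrix_mul_left sym matrix_mul_assoc S)
  finally have "X \<bullet> Y \<le> X \<bullet> (T ** X)" .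
  moreover have "(T ** X) \<bullet> (T ** X) = Y \<bullet> Y"
    by (simp add: inner_matrix_trace matrix_transpose_mul sym T(2)[symmetric] A_def matrix_mul_assoc)
  ultimately have "(X - T ** X) \<bullet> (X - T ** X) \<le> (X - Y) \<bullet> (X - Y)"
    by (simp add: inner_diff_left inner_diff_right inner_commute)
  then show ?thesis
    using bw_dist_transport[OF A T(1) refl] T(2) by (simp add: A_def norm_eq_sqrt_inner)
qed

section \<open>Metric axioms for the Bures--Wasserstein distance\<close>

lemma SPD_factor:
  fixes A :: "real^'n^'n"
  assumes "A \<in> SPD"
  shows "\<exists>X :: real^'n^'n. X ** transpose X = A"
  by (rule exI[of _ "matrix_sqrt A"])
     (simp add: SPD_transpose SPD_matrix_sqrt matrix_sqrt_mul_self assms)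

lemma bw_dist_nonneg:
  fixes A B :: "real^'n^'n"
  assumes "A \<in> SPD" "B \<in> SPD" shows "0 \<le> bw_dist A B"
proof -
  obtain X :: "real^'n^'n" where "X ** transpose X = A" using SPD_factor[OF assms(1)] by blast
  from bw_dist_attained[OF assms this] show ?thesis by auto
qed

lemma bw_dist_commute:
  fixes A B :: "real^'n^'n"
  assumes "A \<in> SPD" "B \<in> SPD" shows "bw_dist A B = bw_dist B A"
proof -
  have "bw_dist B A \<le> bw_dist A B" if AB: "A \<in> SPD" "B \<in> SPD" for A B :: "real^'n^'n"
  proof -
    obtain X :: "real^'n^'n" where X: "X ** transpose X = A" using SPD_factor[OF AB(1)] by blast
    obtain Y where Y: "Y ** transpose Y = B" "bw_dist A B = norm (X - Y)"
      using bw_dist_attained[OF AB X] by blast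
    show ?thesis
      using bw_dist_le_norm[of Y X] AB by (simp add: X Y norm_minus_commute)
  qed
  from this[OF assms] this[OF assms(2,1)] show ?thesis by simp
qed

text \<open>Choose a factor \<open>Y\<close> of \<open>B\<close> optimal for \<open>X\<close>, then
  a factor \<open>Z\<close> of \<open>C\<close> optimal for that same \<open>Y\<close>; the
  Frobenius triangle inequality finishes, as \<open>norm (X - Z)\<close> can only overestimate the
  distance.\<close>

lemma bw_dist_triangle:
  fixes A B C :: "real^'n^'n"
  assumes "A \<in> SPD" "B \<in> SPD" "C \<in> SPD"
  shows "bw_dist A C \<le> bw_dist A B + bw_dist B C"
proof -
  obtain X :: "real^'n^'n" where X: "X ** transpose X = A" using SPD_factor[OF assms(1)] by blast
  obtain Y where Y: "Y ** transpose Y = B" "bw_dist A B = norm (X - Y)"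
    using bw_dist_attained[OF assms(1,2) X] by blast
  obtain Z where Z: "Z ** transpose Z = C" "bw_dist B C = norm (Y - Z)"
    using bw_dist_attained[OF assms(2,3) Y(1)] by blast
  have "bw_dist A C \<le> norm (X - Z)"
    using bw_dist_le_norm[of X Z] assms by (simp add: X Z)
  also have "\<dots> \<le> norm (X - Y) + norm (Y - Z)"
    using norm_triangle_ineq[of "X - Y" "Y - Z"] by simp
  finally show ?thesis by (simp add: Y Z)
qed

section \<open>The product distance\<close>

lemma gdist_eq_norm:
  "gdist V W = norm (norm (fst V - fst W), bw_dist (snd V) (snd W))"
  by (simp add: gdist_def norm_Pair)

text \<open>The Euclidean norm on the plane is monotone in nonnegative coordinates, so the
  componentwise triangle inequalities combine with the one in the plane.\<close>

lemma gdist_triangle: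
  assumes "U \<in> gmanifold" "V \<in> gmanifold" "W \<in> gmanifold"
  shows "gdist U W \<le> gdist U V + gdist V W"
proof -
  have SPD: "snd U \<in> SPD" "snd V \<in> SPD" "snd W \<in> SPD"
    using assms by (auto simp: gmanifold_def)
  let ?a = "(norm (fst U - fst V), bw_dist (snd U) (snd V))"
  let ?b = "(norm (fst V - fst W), bw_dist (snd V) (snd W))"
  have "norm (fst U - fst W) \<le> norm (fst U - fst V) + norm (fst V - fst W)"
    using norm_triangle_ineq[of "fst U - fst V" "fst V - fst W"] by simp
  then have "gdist U W \<le> norm (?a + ?b)"
    using bw_dist_triangle[OF SPD] bw_dist_nonneg[OF SPD(1,3)]
    by (auto simp: gdist_eq_norm norm_Pair intro!: real_sqrt_le_mono add_mono power_mono)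
  also have "\<dots> \<le> gdist U V + gdist V W"
    unfolding gdist_eq_norm by (rule norm_triangle_ineq)
  finally show ?thesis .
qed

lemma gdist_commute:
  "V \<in> gmanifold \<Longrightarrow> W \<in> gmanifold \<Longrightarrow> gdist V W = gdist W V"
  by (auto simp: gdist_def gmanifold_def norm_minus_commute bw_dist_commute)

subsection \<open>Compactness of small balls\<close>

lemma matrix_inv_eq:
  fixes A B :: "real^'n^'n"
  assumes "A ** B = mat 1" shows "matrix_inv A = B"
proof -
  have "invertible A"
    using assms invertible_right_inverse by blast
  then have "matrix_inv A ** (A ** B) = B"
    by (simp add: matrix_mul_assoc matrix_inv_mul)
  then show ?thesis by (simp add: assms)
qed

lemma spectral_norm_bound: "norm (A *v x) \<le> spectral_norm A * norm x"
  unfolding spectral_norm_def by (rule onorm) simp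

lemma spectral_norm_nonneg: "0 \<le> spectral_norm A"
  unfolding spectral_norm_def by (rule onorm_pos_le) simp

text \<open>If \<open>Y\<close> kills \<open>x\<close>, then \<open>S = matrix_sqrt A\<close> sends
  \<open>x\<close> to a vector of norm at most \<open>\<rho> * norm x\<close>. But
  \<open>x \<bullet> x\<close> is the form of \<open>matrix_inv A\<close> at that vector, hence at
  most \<open>\<rho>\<^sup>2 * spectral_norm (matrix_inv A) * (x \<bullet> x)\<close>, which forces
  \<open>x = 0\<close>.\<close>

lemma invertible_near_sqrt:
  fixes A Y :: "real^'n^'n"
  assumes A: "A \<in> SPD" and Y: "norm (Y - matrix_sqrt A) \<le> \<rho>"
    and \<rho>: "\<rho>\<^sup>2 * spectral_norm (matrix_inv A) < 1"
  shows "invertible Y"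
proof -
  define S where "S = matrix_sqrt A"
  have S: "S \<in> SPD" "S ** S = A"
    using A by (simp_all add: S_def SPD_matrix_sqrt matrix_sqrt_mul_self)
  define I where "I = matrix_inv S"
  have I: "I \<in> SPD" "S ** I = mat 1" "I ** S = mat 1"
    using S(1) by (simp_all add: I_def SPD_inv matrix_inv_mul SPD_invertible)
  have "A ** (I ** I) = S ** (S ** I) ** I"
    by (simp add: S(2)[symmetric] matrix_mul_assoc)
  then have inv: "matrix_inv A = I ** I"
    by (intro matrix_inv_eq) (simp add: I)
  have "x = 0" if "Y *v x = 0" for x
  proof (rule ccontr)
    assume "x \<noteq> 0"
    let ?s = "spectral_norm (matrix_inv A)"
    have "norm (S *v x) = norm ((Y - S) *v x)"
      by (simp add: matrix_vector_mult_diff_rdistrib that)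
    also have "\<dots> \<le> norm (Y - S) * norm x"
      by (rule norm_matrix_vector_mul_le)
    also have "\<dots> \<le> \<rho> * norm x"
      using Y by (simp add: S_def mult_right_mono)
    finally have Sx: "norm (S *v x) \<le> \<rho> * norm x" .
    have "x = I *v (S *v x)"
      by (simp add: matrix_vector_mul_assoc I)
    then have "x \<bullet> x = (I *v (S *v x)) \<bullet> (I *v (S *v x))"
      by simp
    also have "\<dots> = (S *v x) \<bullet> (matrix_inv A *v (S *v x))"
      using transpose_symmetric_inner[OF SPD_transpose[OF I(1)], of "S *v x" "I *v (S *v x)"]
      by (simp add: inv matrix_vector_mul_assoc matrix_mul_assoc)
    also have "\<dots> \<le> norm (S *v x) * (?s * norm (S *v x))"
      by (intro order.trans[OF norm_cauchy_schwarz] mult_left_mono spectral_norm_bound) simp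
    also have "\<dots> = ?s * (norm (S *v x))\<^sup>2"
      by (simp add: power2_eq_square)
    also have "\<dots> \<le> ?s * (\<rho> * norm x)\<^sup>2"
      by (intro mult_left_mono power_mono Sx spectral_norm_nonneg) simp
    also have "\<dots> = (\<rho>\<^sup>2 * ?s) * (x \<bullet> x)"
      by (simp add: power_mult_distrib dot_square_norm)
    also have "\<dots> < 1 * (x \<bullet> x)"
      using \<rho> \<open>x \<noteq> 0\<close> by (intro mult_strict_right_mono) simp_all
    finally show False by simp
  qed
  then show ?thesis
    unfolding invertible_left_inverse matrix_left_invertible_ker by blast
qed

text \<open>Exhibits the ball as a continuous image of a compact Frobenius ball. The radius
  condition keeps every factor invertible, so no image point leaves \<open>SPD\<close>.\<close>

lemma bw_cball_eq_image:
  fixes A :: "real^'n^'n"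
  assumes A: "A \<in> SPD" and \<rho>: "\<rho>\<^sup>2 * spectral_norm (matrix_inv A) < 1"
  shows "{B \<in> SPD. bw_dist B A \<le> \<rho>} = (\<lambda>Y. Y ** transpose Y) ` cball (matrix_sqrt A) \<rho>"
proof -
  define S where "S = matrix_sqrt A"
  have S: "S ** transpose S = A"
    using SPD_matrix_sqrt[OF A] matrix_sqrt_mul_self[OF A] by (simp add: S_def SPD_transpose)
  have "B \<in> (\<lambda>Y. Y ** transpose Y) ` cball S \<rho>" if B: "B \<in> SPD" "bw_dist B A \<le> \<rho>" for B
  proof -
    obtain Y where "Y ** transpose Y = B" "bw_dist A B = norm (S - Y)"
      using bw_dist_attained[OF A B(1) S] by blast
    then show ?thesis
      using B(2) bw_dist_commute[OF A B(1)] by (auto simp: dist_norm)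
  qed
  moreover have "Y ** transpose Y \<in> SPD \<and> bw_dist (Y ** transpose Y) A \<le> \<rho>" if "Y \<in> cball S \<rho>" for Y
  proof -
    have Y: "norm (Y - S) \<le> \<rho>"
      using that by (simp add: dist_norm norm_minus_commute)
    then have "Y ** transpose Y \<in> SPD"
      using invertible_near_sqrt[OF A _ \<rho>, of Y] by (intro SPD_mul_transpose) (simp add: S_def)
    then show ?thesis
      using bw_dist_le_norm[of Y S] S A Y by simp
  qed
  ultimately show ?thesis
    unfolding S_def[symmetric] by blast
qed

lemma compact_gcball:
  fixes V0 :: "'n::finite gparam"
  assumes "snd V0 \<in> SPD" "\<rho>\<^sup>2 * spectral_norm (matrix_inv (snd V0)) < 1"
  shows "compact (gcball V0 \<rho>)"
proof -
  have "gcball V0 \<rho> = cball (fst V0) \<rho> \<times> {B \<in> SPD. bw_dist B (snd V0) \<le> \<rho>}"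
    by (auto simp: gcball_def gmanifold_def dist_commute)
  then show ?thesis
    unfolding bw_cball_eq_image[OF assms]
    by (simp, intro compact_Times compact_cball compact_continuous_image continuous_intros)
qed

subsection \<open>The Bures--Wasserstein metric and its gradient\<close>

lemma lyapunov_eq:
  fixes A U X :: "real^'n^'n"
  assumes "A \<in> SPD" "transpose X = X" "A ** X + X ** A = U"
  shows "lyapunov A U = X"
  unfolding lyapunov_def
proof (rule the_equality)
  fix Y assume "transpose Y = Y \<and> A ** Y + Y ** A = U"
  then have "A ** (Y - X) + (Y - X) ** A = 0"
    using assms(3) by (simp add: matrix_mul_distribs algebra_simps)
  from SPD_sylvester_zero[OF assms(1,1) this] show "Y = X" by simp
qed (use assms in auto)

text \<open>An injective linear endomorphism is surjective; symmetry of the solution follows from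
  uniqueness.\<close>

lemma lyapunov:
  fixes A U :: "real^'n^'n"
  assumes A: "A \<in> SPD" and U: "transpose U = U"
  shows "transpose (lyapunov A U) = lyapunov A U"
    and "A ** lyapunov A U + lyapunov A U ** A = U"
proof -
  let ?f = "\<lambda>X :: real^'n^'n. A ** X + X ** A"
  have lin: "linear ?f"
    by (rule linearI) (simp_all add: matrix_mul_distribs algebra_simps)
  have "inj ?f"
    unfolding linear_injective_0[OF lin] using SPD_sylvester_zero[OF A A] by blast
  then have "surj ?f"
    by (rule linear_inj_imp_surj[OF lin])
  then obtain X where X: "A ** X + X ** A = U"
    using surjD[of ?f U] by metis
  then have "transpose (A ** X + X ** A) = U"
    using U by simp
  then have "A ** transpose X + transpose X ** A = U"
    by (simp add: transpose_add matrix_transpose_mul SPD_transpose[OF A] add.commute)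
  then have "A ** (transpose X - X) + (transpose X - X) ** A = 0"
    using X by (simp add: matrix_mul_distribs algebra_simps)
  from SPD_sylvester_zero[OF A A this] have "transpose X = X"
    by simp
  with X lyapunov_eq[OF A this X] show "transpose (lyapunov A U) = lyapunov A U"
    "A ** lyapunov A U + lyapunov A U ** A = U" by simp_all
qed

text \<open>Turns the metric into a pulled-back Frobenius inner product, from which positivity and
  Cauchy--Schwarz follow.\<close>

lemma bw_metric_eq_inner:
  fixes A U W :: "real^'n^'n"
  assumes A: "A \<in> SPD" and UW: "transpose U = U" "transpose W = W"
  shows "bw_metric A U W
    = (lyapunov A U ** matrix_sqrt A) \<bullet> (lyapunov A W ** matrix_sqrt A)"
proof -
  have "lyapunov A U ** A ** lyapunov A W
    = (lyapunov A U ** matrix_sqrt A) ** (matrix_sqrt A ** lyapunov A W)"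
    using matrix_sqrt_mul_self[OF A] by (metis matrix_mul_assoc)
  then show ?thesis
    by (simp add: bw_metric_def inner_matrix_trace matrix_transpose_mul lyapunov[OF A UW(2)]
        SPD_transpose SPD_matrix_sqrt A)
qed

text \<open>By symmetry \<open>A ** ?W\<close> and \<open>?W ** A\<close> pair equally with
  \<open>?U\<close>, and they add up to \<open>W\<close>; hence the factor one half. This form
  converts ambient derivatives into Riemannian gradients.\<close>

lemma bw_metric_eq_half_inner:
  fixes A U W :: "real^'n^'n"
  assumes A: "A \<in> SPD" and UW: "transpose U = U" "transpose W = W"
  shows "bw_metric A U W = (lyapunov A U \<bullet> W) / 2"
proof -
  let ?U = "lyapunov A U" and ?W = "lyapunov A W"
  have "bw_metric A U W = ?U \<bullet> (?W ** A)"
    by (simp add: bw_metric_eq_inner assms inner_matrix_mul_right SPD_transpose SPD_matrix_sqrt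
        matrix_mul_assoc[symmetric] matrix_sqrt_mul_self)
  moreover have "?U \<bullet> (A ** ?W) = ?U \<bullet> (?W ** A)"
    using inner_transpose[of ?U "A ** ?W"]
    by (simp add: matrix_transpose_mul lyapunov[OF A] UW SPD_transpose[OF A])
  moreover have "?U \<bullet> W = ?U \<bullet> (A ** ?W) + ?U \<bullet> (?W ** A)"
    by (metis inner_add_right lyapunov(2)[OF A UW(2)])
  ultimately show ?thesis by simp
qed

lemma
  assumes V: "V \<in> gmanifold" and a: "a \<in> gtangent"
  shows gnorm_nonneg: "0 \<le> gnorm V a"
    and gmetric_le_gnorm: "b \<in> gtangent \<Longrightarrow> \<bar>gmetric V a b\<bar> \<le> gnorm V a * gnorm V b"
proof -
  define e where "e c = (fst c, lyapunov (snd V) (snd c) ** matrix_sqrt (snd V))" for c :: "'a gparam"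
  have e: "gmetric V c d = e c \<bullet> e d" if "c \<in> gtangent" "d \<in> gtangent" for c d
    using that V by (auto simp: e_def gmetric_def gmanifold_def gtangent_def bw_metric_eq_inner)
  show "0 \<le> gnorm V a"
    by (simp add: gnorm_def e a)
  show "\<bar>gmetric V a b\<bar> \<le> gnorm V a * gnorm V b" if "b \<in> gtangent"
    using Cauchy_Schwarz_ineq2[of "e a" "e b"] by (simp add: gnorm_def e a that norm_eq_sqrt_inner)
qed

section \<open>The Riemannian gradient\<close>

lemma gmanifold_line:
  fixes V a :: "'n::finite gparam"
  assumes "V \<in> gmanifold" "a \<in> gtangent"
  shows "\<exists>\<delta>>0. \<forall>t\<in>{0..\<delta>}. V + t *\<^sub>R a \<in> gmanifold"
proof -
  define A U where "A = snd V" and "U = snd a"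
  have A: "A \<in> SPD" and U: "transpose U = U"
    using assms by (auto simp: A_def U_def gmanifold_def gtangent_def)
  obtain l where l: "0 < l" "\<And>x. l * (x \<bullet> x) \<le> x \<bullet> (A *v x)"
    using SPD_lower_bound[OF A] by metis
  \<comment> \<open>Within this range the perturbation changes the quadratic form by less than its
    lower bound \<open>l * (x \<bullet> x)\<close>; the summand 1 covers
    \<open>U = 0\<close>.\<close>
  define \<delta> where "\<delta> = l / (norm U + 1)"
  have N: "0 < norm U + 1" by (simp add: add_nonneg_pos)
  then have \<delta>: "0 < \<delta>" using l by (simp add: \<delta>_def)
  have "A + t *\<^sub>R U \<in> SPD" if t: "t \<in> {0..\<delta>}" for t
  proof -
    have "0 < x \<bullet> ((A + t *\<^sub>R U) *v x)" if "x \<noteq> 0" for x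
    proof -
      have "\<bar>x \<bullet> (U *v x)\<bar> \<le> norm x * (norm U * norm x)"
        by (intro order.trans[OF Cauchy_Schwarz_ineq2] mult_left_mono norm_matrix_vector_mul_le) simp
      then have "t * \<bar>x \<bullet> (U *v x)\<bar> \<le> t * (norm U * (x \<bullet> x))"
        using t by (intro mult_left_mono) (simp_all add: dot_square_norm power2_eq_square mult_ac)
      also have "\<dots> \<le> \<delta> * (norm U * (x \<bullet> x))"
        using t by (intro mult_right_mono) auto
      also have "\<dots> < \<delta> * ((norm U + 1) * (x \<bullet> x))"
        using \<delta> that by (intro mult_strict_left_mono) (simp_all add: distrib_right)
      also have "\<dots> = l * (x \<bullet> x)"
        using N by (simp add: \<delta>_def)
      also have "\<dots> \<le> x \<bullet> (A *v x)" by (rule l)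
      finally have "t * \<bar>x \<bullet> (U *v x)\<bar> < x \<bullet> (A *v x)" .
      moreover have "- (t * \<bar>x \<bullet> (U *v x)\<bar>) \<le> t * (x \<bullet> (U *v x))"
        using t abs_ge_minus_self[of "t * (x \<bullet> (U *v x))"] by (simp add: abs_mult)
      ultimately show ?thesis
        by (simp add: matrix_vector_mult_add_rdistrib scaleR_matrix_vector_assoc[symmetric] inner_add_right)
    qed
    then show ?thesis
      using A U by (simp add: SPD_def transpose_add transpose_scalar)
  qed
  then have "\<forall>t\<in>{0..\<delta>}. V + t *\<^sub>R a \<in> gmanifold"
    by (simp add: gmanifold_def A_def U_def mem_Times_iff)
  with \<delta> show ?thesis by blast
qed

text \<open>A derivative within the manifold may be ambiguous on nonsymmetric directions. In a
  tangent direction a short segment stays inside the manifold, and one-sided differentiation along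
  it determines the value.\<close>

lemma derivative_on_gtangent_unique:
  assumes V: "V \<in> gmanifold" and a: "a \<in> gtangent"
    and F: "(F has_derivative F1) (at V within gmanifold)" "(F has_derivative F2) (at V within gmanifold)"
  shows "F1 a = (F2 a :: real)"
proof -
  obtain \<delta> where \<delta>: "0 < \<delta>" "\<And>t. t \<in> {0..\<delta>} \<Longrightarrow> V + t *\<^sub>R a \<in> gmanifold"
    using gmanifold_line[OF V a] by blast
  have deriv: "((\<lambda>t. F (V + t *\<^sub>R a)) has_vector_derivative F' a) (at 0 within {0..\<delta>})"
    if F': "(F has_derivative F') (at V within gmanifold)" for F'
  proof -
    have "((\<lambda>t. V + t *\<^sub>R a) has_vector_derivative a) (at 0 within {0..\<delta>})"
      by (auto intro!: derivative_eq_intros)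
    moreover have "(F has_derivative F') (at (V + 0 *\<^sub>R a) within (\<lambda>t. V + t *\<^sub>R a) ` {0..\<delta>})"
      using F' \<delta>(2) by (auto intro: has_derivative_subset)
    ultimately show ?thesis
      using vector_derivative_diff_chain_within[of "\<lambda>t. V + t *\<^sub>R a" a 0 "{0..\<delta>}" F F']
      by (simp add: o_def)
  qed
  have "at 0 within {0..\<delta>} \<noteq> bot"
    using \<delta>(1) by (simp add: trivial_limit_within islimpt_Icc)
  then show ?thesis
    using deriv[OF F(1)] deriv[OF F(2)] by (rule vector_derivative_unique_within)
qed

lemma ggrad:
  fixes V :: "'n::finite gparam"
  assumes V: "V \<in> gmanifold" and F: "(F has_derivative F') (at V within gmanifold)"
  shows "ggrad F V \<in> gtangent" and "a \<in> gtangent \<Longrightarrow> F' a = gmetric V (ggrad F V) a"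
proof -
  define A where "A = snd V"
  have A: "A \<in> SPD" using V by (auto simp: A_def gmanifold_def)
  have lin: "linear F'" using F by (rule has_derivative_linear)
  \<comment> \<open>\<open>g0\<close> is the ambient Euclidean gradient. Only its symmetric part
    \<open>W\<close> pairs with tangent vectors, and the factor 2 in \<open>g\<close> compensates
    the half in \<open>bw_metric_eq_half_inner\<close>.\<close>
  define g0 where "g0 = adjoint F' 1"
  have g0: "F' b = b \<bullet> g0" for b
    using adjoint_works[OF lin, of b 1] by (simp add: g0_def)
  define W where "W = (1/2) *\<^sub>R (snd g0 + transpose (snd g0))"
  have W: "transpose W = W"
    by (simp add: W_def transpose_scalar transpose_add add.commute)
  have WU: "W \<bullet> U = snd g0 \<bullet> U" if "transpose U = U" for U
    using inner_transpose[of "snd g0" U] that by (simp add: W_def inner_add_left)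
  define g where "g = (fst g0, A ** (2 *\<^sub>R W) + (2 *\<^sub>R W) ** A)"
  have sym: "transpose (snd g) = snd g"
    by (simp add: g_def transpose_add matrix_transpose_mul transpose_scalar W SPD_transpose[OF A] add.commute)
  then have gT: "g \<in> gtangent" by (simp add: gtangent_def mem_Times_iff)
  have L: "lyapunov A (snd g) = 2 *\<^sub>R W"
    by (rule lyapunov_eq[OF A]) (simp_all add: g_def transpose_scalar W)
  have Fg: "F' b = gmetric V g b" if "b \<in> gtangent" for b
  proof -
    have b: "transpose (snd b) = snd b" using that by (auto simp: gtangent_def)
    then have "bw_metric A (snd g) (snd b) = snd g0 \<bullet> snd b"
      by (simp add: bw_metric_eq_half_inner[OF A sym] L WU)
    moreover have "fst g = fst g0" by (simp add: g_def)
    ultimately show ?thesis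
      by (simp add: g0 gmetric_def A_def inner_prod_def inner_commute)
  qed
  have "ggrad F V = g"
    unfolding ggrad_def
  proof (rule the_equality)
    show "g \<in> gtangent \<and> (\<exists>F'. (F has_derivative F') (at V within gmanifold) \<and>
      (\<forall>a\<in>gtangent. F' a = gmetric V g a))"
      using gT F Fg by blast
  next
    fix h assume "h \<in> gtangent \<and> (\<exists>F'. (F has_derivative F') (at V within gmanifold) \<and>
      (\<forall>a\<in>gtangent. F' a = gmetric V h a))"
    then obtain F2 where h: "h \<in> gtangent" and F2: "(F has_derivative F2) (at V within gmanifold)"
      "\<And>a. a \<in> gtangent \<Longrightarrow> F2 a = gmetric V h a" by blast
    have eq: "gmetric V h b = gmetric V g b" if "b \<in> gtangent" for b
      using derivative_on_gtangent_unique[OF V that F F2(1)] F2(2)[OF that] Fg[OF that] by simp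
    have hs: "transpose (snd h) = snd h" using h by (auto simp: gtangent_def)
    \<comment> \<open>Testing against the difference of the Lyapunov images, rather than of the
      matrices themselves, turns equality of the two metric pairings into a vanishing sum of
      squares.\<close>
    let ?D = "lyapunov A (snd h) - lyapunov A (snd g)"
    have Dsym: "transpose ?D = ?D"
      by (simp add: transpose_diff lyapunov[OF A] hs sym)
    have "gmetric V h (fst h - fst g, ?D) = gmetric V g (fst h - fst g, ?D)"
      by (intro eq) (simp add: gtangent_def Dsym)
    then have "fst h \<bullet> (fst h - fst g) + (lyapunov A (snd h) \<bullet> ?D) / 2
      = fst g \<bullet> (fst h - fst g) + (lyapunov A (snd g) \<bullet> ?D) / 2"
      by (simp add: gmetric_def A_def[symmetric] bw_metric_eq_half_inner[OF A hs Dsym]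
          bw_metric_eq_half_inner[OF A sym Dsym])
    then have "(fst h - fst g) \<bullet> (fst h - fst g) + (?D \<bullet> ?D) / 2 = 0"
      unfolding inner_diff_left[of "fst h" "fst g"]
        inner_diff_left[of "lyapunov A (snd h)" "lyapunov A (snd g)"]
      by (simp add: diff_divide_distrib)
    moreover have "0 \<le> (fst h - fst g) \<bullet> (fst h - fst g)" "0 \<le> ?D \<bullet> ?D" by simp_all
    ultimately have "(fst h - fst g) \<bullet> (fst h - fst g) = 0" "?D \<bullet> ?D = 0" by linarith+
    then have eqs: "fst h = fst g" "lyapunov A (snd h) = lyapunov A (snd g)" by simp_all
    have "snd h = snd g"
      using lyapunov(2)[OF A hs] unfolding eqs(2) lyapunov(2)[OF A sym] by simp
    with eqs(1) show "h = g"
      by (simp add: prod_eq_iff)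
  qed
  then show "ggrad F V \<in> gtangent" and "a \<in> gtangent \<Longrightarrow> F' a = gmetric V (ggrad F V) a"
    using gT Fg by simp_all
qed

subsection \<open>Geodesics\<close>

text \<open>With \<open>T\<close> the transport map from \<open>\<Lambda>\<close> to \<open>\<Lambda>'\<close>, the geodesic is
  \<open>((1 - t) 1 + t T) \<Lambda> ((1 - t) 1 + t T)\<close>; its initial velocity has Lyapunov image \<open>T - 1\<close>.\<close>

lemma gmanifold_geodesic:
  fixes V W :: "'n::finite gparam"
  assumes V: "V \<in> gmanifold" and W: "W \<in> gmanifold"
  shows "\<exists>c a. c 0 = V \<and> a \<in> gtangent \<and> gnorm V a = gdist V W \<and> c ` {0..1} \<subseteq> gmanifold \<and>
    (c has_vector_derivative a) (at 0 within {0..1}) \<and>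
    (\<forall>t\<in>{0..1}. norm (fst (c t) - fst W) = (1 - t) * norm (fst V - fst W) \<and>
       bw_dist (snd (c t)) (snd W) \<le> (1 - t) * bw_dist (snd V) (snd W))"
proof -
  define A B where "A = snd V" and "B = snd W"
  have A: "A \<in> SPD" and B: "B \<in> SPD"
    using V W by (auto simp: A_def B_def gmanifold_def)
  obtain T where T: "T \<in> SPD" "T ** A ** T = B"
    using transport_exists[OF A B] by blast
  define S where "S = matrix_sqrt A"
  have S: "transpose S = S" "S ** S = A"
    using A by (simp_all add: S_def SPD_matrix_sqrt matrix_sqrt_mul_self SPD_transpose)
  have bw: "bw_dist A B = norm (S - T ** S)"
    using bw_dist_transport[OF A T(1), of S] by (simp add: S T(2))
  define M where "M t = (1 - t) *\<^sub>R mat 1 + t *\<^sub>R T" for t :: real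
  define c where "c t = (fst V + t *\<^sub>R (fst W - fst V), M t ** A ** M t)" for t
  define a where "a = (fst W - fst V, (T - mat 1) ** A + A ** (T - mat 1))"
  have symT: "transpose (T - mat 1) = T - mat 1"
    by (simp add: transpose_diff SPD_transpose[OF T(1)])
  have aT: "a \<in> gtangent"
    using symT by (simp add: a_def gtangent_def transpose_add matrix_transpose_mul SPD_transpose[OF A] add.commute)
  have norm_a: "gnorm V a = gdist V W"
  proof -
    have L: "lyapunov A (snd a) = T - mat 1"
      by (rule lyapunov_eq[OF A symT]) (simp add: a_def add.commute)
    have "transpose (snd a) = snd a" using aT by (auto simp: gtangent_def)
    then have "bw_metric A (snd a) (snd a) = ((T - mat 1) ** S) \<bullet> ((T - mat 1) ** S)"
      by (simp add: bw_metric_eq_inner[OF A] L S_def)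
    also have "\<dots> = (bw_dist A B)\<^sup>2"
      unfolding bw power2_norm_eq_inner by (simp add: matrix_mul_diff_left inner_diff_left inner_diff_right)
    finally show ?thesis
      by (simp add: gnorm_def gmetric_def gdist_def A_def B_def a_def power2_norm_eq_inner[symmetric] norm_minus_commute)
  qed
  have M: "M t \<in> SPD" if "t \<in> {0..1}" for t
    using that SPD_convex[OF SPD_mat1 T(1)] by (simp add: M_def)
  have MAM: "M t ** A ** M t \<in> SPD" if "t \<in> {0..1}" for t
    using SPD_congruence[OF A SPD_invertible[OF M[OF that]]] by (simp add: SPD_transpose[OF M[OF that]])
  have "c 0 = V"
    by (simp add: c_def M_def A_def)
  moreover have "c ` {0..1} \<subseteq> gmanifold"
    using MAM by (auto simp: c_def gmanifold_def)
  moreover have "(c has_vector_derivative a) (at 0 within {0..1})"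
  proof -
    have dM: "(M has_vector_derivative T - mat 1) (at 0 within {0..1})"
      unfolding M_def by (auto intro!: derivative_eq_intros)
    have "((\<lambda>t. M t ** A) has_vector_derivative (T - mat 1) ** A) (at 0 within {0..1})"
      by (rule bounded_linear.has_vector_derivative[OF bounded_bilinear.bounded_linear_left[OF bounded_bilinear_matrix_mul] dM])
    from bounded_bilinear.has_vector_derivative[OF bounded_bilinear_matrix_mul this dM]
    have "((\<lambda>t. M t ** A ** M t) has_vector_derivative snd a) (at 0 within {0..1})"
      by (simp add: M_def a_def add.commute)
    moreover have "((\<lambda>t. fst V + t *\<^sub>R (fst W - fst V)) has_vector_derivative fst a) (at 0 within {0..1})"
      by (auto intro!: derivative_eq_intros simp: a_def)
    ultimately show ?thesis
      using has_vector_derivative_Pair[of "\<lambda>t. fst V + t *\<^sub>R (fst W - fst V)" "fst a" 0 "{0..1}"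
          "\<lambda>t. M t ** A ** M t" "snd a"]
      by (simp add: c_def[abs_def])
  qed
  moreover have "norm (fst (c t) - fst W) = (1 - t) * norm (fst V - fst W)" if "t \<in> {0..1}" for t
  proof -
    have "fst (c t) - fst W = (1 - t) *\<^sub>R (fst V - fst W)"
      by (simp add: c_def algebra_simps)
    then show ?thesis using that by simp
  qed
  moreover have "bw_dist (snd (c t)) (snd W) \<le> (1 - t) * bw_dist (snd V) (snd W)" if "t \<in> {0..1}" for t
  proof -
    \<comment> \<open>In factor space the curve is the straight segment from \<open>S\<close> to
      \<open>T ** S\<close>, so the remaining distance to the endpoint shrinks at least
      linearly.\<close>
    have 1: "(M t ** S) ** transpose (M t ** S) = M t ** A ** M t"
      by (simp add: matrix_transpose_mul SPD_transpose[OF M[OF that]] S(1) S(2)[symmetric] matrix_mul_assoc)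
    have 2: "(T ** S) ** transpose (T ** S) = B"
      by (simp add: matrix_transpose_mul SPD_transpose[OF T(1)] S(1) S(2)[symmetric] T(2)[symmetric] matrix_mul_assoc)
    have "bw_dist (M t ** A ** M t) B \<le> norm (M t ** S - T ** S)"
      using bw_dist_le_norm[of "M t ** S" "T ** S"] MAM[OF that] B by (simp add: 1 2)
    also have "M t ** S - T ** S = (1 - t) *\<^sub>R (S - T ** S)"
      by (simp add: M_def matrix_mul_distribs algebra_simps)
    finally show ?thesis
      using that by (simp add: bw c_def A_def[symmetric] B_def[symmetric])
  qed
  ultimately show ?thesis using aT norm_a by blast
qed

subsection \<open>The penalized problem\<close>

text \<open>First-order condition at the left endpoint: divide by \<open>t > 0\<close> and let
  \<open>t\<close> tend to 0.\<close>

lemma has_vector_derivative_upper_bound: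
  fixes f :: "real \<Rightarrow> real"
  assumes f: "(f has_vector_derivative D) (at 0 within {0..1})"
    and le: "\<And>t. t \<in> {0<..1} \<Longrightarrow> f t - f 0 \<le> t * h t"
    and h: "(h \<longlongrightarrow> l) (at 0 within {0..1})"
  shows "D \<le> l"
proof (rule tendsto_le)
  show "at 0 within {0..1::real} \<noteq> bot"
    by (simp add: trivial_limit_within islimpt_Icc)
  show "((\<lambda>t. (f t - f 0) / t) \<longlongrightarrow> D) (at 0 within {0..1})"
    using f by (simp add: has_real_derivative_iff_has_vector_derivative[symmetric] has_field_derivative_iff)
  show "\<forall>\<^sub>F t in at 0 within {0..1}. (f t - f 0) / t \<le> h t"
    unfolding eventually_at_filter
    using le by (intro always_eventually) (auto simp: pos_divide_le_eq mult.commute)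
qed (rule h)

lemma penalized_maximizer_gdist_le:
  fixes V V0 :: "'n::finite gparam"
  assumes V0: "V0 \<in> gmanifold" and V: "V \<in> gcball V0 r"
    and F: "F differentiable (at V within gmanifold)"
    and max: "\<And>W. W \<in> gcball V0 r \<Longrightarrow> F W - 1 / \<epsilon> * \<psi> V0 W \<le> F V - 1 / \<epsilon> * \<psi> V0 V"
    and \<epsilon>: "0 < \<epsilon>"
  shows "gdist V V0 \<le> \<epsilon> * gnorm V (ggrad F V) / 2"
proof -
  have VM: "V \<in> gmanifold" using V by (simp add: gcball_def)
  obtain F' where F': "(F has_derivative F') (at V within gmanifold)"
    using F by (auto simp: differentiable_def)
  define d where "d = gdist V V0"
  have \<psi>d: "\<psi> V0 V = d\<^sup>2"
    by (simp add: \<psi>_def d_def gdist_def)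
  obtain c a where c: "c 0 = V" "a \<in> gtangent" "gnorm V a = d" "c ` {0..1} \<subseteq> gmanifold"
    "(c has_vector_derivative a) (at 0 within {0..1})"
    and closer: "\<And>t. t \<in> {0..1} \<Longrightarrow> norm (fst (c t) - fst V0) = (1 - t) * norm (fst V - fst V0)"
      "\<And>t. t \<in> {0..1} \<Longrightarrow> bw_dist (snd (c t)) (snd V0) \<le> (1 - t) * bw_dist (snd V) (snd V0)"
    using gmanifold_geodesic[OF VM V0] unfolding d_def by blast
  have bw_nonneg: "0 \<le> bw_dist (snd W) (snd V0)" if "W \<in> gmanifold" for W :: "'n gparam"
    using that V0 by (auto simp: gmanifold_def intro: bw_dist_nonneg)
  have cM: "c t \<in> gmanifold" if "t \<in> {0..1}" for t
    using c(4) that by blast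
  have shrink: "(1 - t) * x \<le> x" if "t \<in> {0..1}" "0 \<le> x" for t x :: real
    using that by (simp add: algebra_simps)
  \<comment> \<open>Both component distances to the centre shrink along the curve, so maximality
    over the ball applies at each of its points.\<close>
  have cball: "c t \<in> gcball V0 r" if t: "t \<in> {0..1}" for t
    using V cM[OF t] closer[OF t] shrink[OF t, of "norm (fst V - fst V0)"] shrink[OF t bw_nonneg[OF VM]]
    by (simp add: gcball_def dist_norm)
  have \<psi>c: "\<psi> V0 (c t) \<le> (1 - t)\<^sup>2 * d\<^sup>2" if t: "t \<in> {0..1}" for t
  proof -
    have "(bw_dist (snd (c t)) (snd V0))\<^sup>2 \<le> ((1 - t) * bw_dist (snd V) (snd V0))\<^sup>2"
      by (intro power_mono closer(2)[OF t] bw_nonneg cM[OF t])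
    then show ?thesis
      unfolding \<psi>d[symmetric] by (simp add: \<psi>_def closer(1)[OF t] power_mult_distrib distrib_left)
  qed
  have "((\<lambda>t. F (c t)) has_vector_derivative F' a) (at 0 within {0..1})"
    using vector_derivative_diff_chain_within[OF c(5), of F F'] F' c(1,4)
    by (auto simp: o_def intro: has_derivative_subset)
  moreover have "F (c t) - F (c 0) \<le> t * (1 / \<epsilon> * (d\<^sup>2 * (t - 2)))" if "t \<in> {0<..1}" for t
  proof -
    have t: "t \<in> {0..1}" using that by simp
    have "F (c t) - F V \<le> 1 / \<epsilon> * (\<psi> V0 (c t) - \<psi> V0 V)"
      using max[OF cball[OF t]] by (simp add: right_diff_distrib)
    also have "\<dots> \<le> 1 / \<epsilon> * ((1 - t)\<^sup>2 * d\<^sup>2 - d\<^sup>2)"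
      using \<psi>c[OF t] \<epsilon> by (intro mult_left_mono) (simp_all add: \<psi>d)
    also have "(1 - t)\<^sup>2 * d\<^sup>2 - d\<^sup>2 = t * (d\<^sup>2 * (t - 2))"
      by (simp add: power2_eq_square algebra_simps)
    finally show ?thesis by (simp add: c(1))
  qed
  moreover have "((\<lambda>t. 1 / \<epsilon> * (d\<^sup>2 * (t - 2))) \<longlongrightarrow> 1 / \<epsilon> * (d\<^sup>2 * (0 - 2))) (at 0 within {0..1})"
    by (intro tendsto_intros)
  ultimately have "F' a \<le> 1 / \<epsilon> * (d\<^sup>2 * (0 - 2))"
    by (rule has_vector_derivative_upper_bound)
  moreover have "- (gnorm V (ggrad F V) * d) \<le> F' a"
    using gmetric_le_gnorm[OF VM ggrad(1)[OF VM F'] c(2)] ggrad(2)[OF VM F' c(2)] c(3) by simp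
  ultimately have "2 * d\<^sup>2 / \<epsilon> \<le> gnorm V (ggrad F V) * d"
    by simp
  then have "d * d \<le> d * (\<epsilon> * gnorm V (ggrad F V) / 2)"
    using \<epsilon> by (simp add: field_simps power2_eq_square)
  \<comment> \<open>A factor \<open>d\<close> can be cancelled only if it is nonzero; for
    \<open>d = 0\<close> the claim is exactly this nonnegativity.\<close>
  moreover have "0 \<le> \<epsilon> * gnorm V (ggrad F V) / 2"
    using \<epsilon> gnorm_nonneg[OF VM ggrad(1)[OF VM F']] by simp
  moreover have "0 \<le> d" by (simp add: d_def gdist_def)
  ultimately show ?thesis
    unfolding d_def[symmetric] by (cases "d = 0") (simp_all add: mult_le_cancel_left)
qed

text \<open>The two components are bounded separately by \<open>\<xi>\<close>, hence the factor 2.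
  It is the source of both \<open>sqrt 2\<close> and \<open>2 * \<xi>\<^sup>2 / \<epsilon>\<close>
  in the final bounds.\<close>

lemma gcball_\<psi>_le:
  assumes "V0 \<in> gmanifold" "V \<in> gcball V0 \<xi>"
  shows "\<psi> V0 V \<le> 2 * \<xi>\<^sup>2"
proof -
  have "0 \<le> bw_dist (snd V) (snd V0)"
    using assms by (auto simp: gcball_def gmanifold_def intro: bw_dist_nonneg)
  then have "(norm (fst V - fst V0))\<^sup>2 \<le> \<xi>\<^sup>2" "(bw_dist (snd V) (snd V0))\<^sup>2 \<le> \<xi>\<^sup>2"
    using assms by (auto simp: gcball_def dist_norm intro: power_mono)
  then show ?thesis by (simp add: \<psi>_def)
qed

lemma gdist_eq_sqrt_\<psi>: "gdist V V0 = sqrt (\<psi> V0 V)"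
  by (simp add: gdist_def \<psi>_def)

theorem proposition17:
  fixes loss :: "real^'d \<Rightarrow> real^'n \<Rightarrow> real"
    and \<mu>s :: "real^'n" and \<Lambda>s :: "real^'n^'n" and Vs :: "'n gparam"
    and w0 :: "real^'d" and R \<gamma> r m \<epsilon> \<xi> L\<^sub>G :: real
    and S1 :: "(real^'d) set" and S2 K :: "'n gparam set"
    and V\<epsilon> :: "real^'d \<Rightarrow> 'n gparam"
  assumes "\<Lambda>s \<in> SPD" and "Vs = (\<mu>s, \<Lambda>s)"
    and "assumption_A1 loss" and "assumption_A2 loss Vs"
    and "0 < R" and "S1 = cball w0 R"
    and "0 < \<gamma>" and "\<gamma> < 1"
    and "r = (1 - \<gamma>) * spectral_norm (matrix_inv \<Lambda>s) powr (- 1 / 2)"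
    and "(1 - \<gamma>) * spectral_norm (matrix_inv \<Lambda>s) powr (- 1 / 2)
           < \<gamma>\<^sup>2 * pi * spectral_norm (matrix_inv \<Lambda>s) powr (- 1) / sqrt 3"
    and "S2 = gcball Vs r"
    and "\<exists>N. normal_neighborhood Vs N \<and> S2 \<subseteq> N"
    \<comment> \<open>the gradients in the definition of \<open>L\<^sub>G\<close> exist, and the supremum is finite\<close>
    and "\<And>w V. w \<in> S1 \<Longrightarrow> V \<in> S2 \<Longrightarrow> integrable (gaussian (fst V) (snd V)) (loss w)"
    and "\<And>w V. w \<in> S1 \<Longrightarrow> V \<in> S2 \<Longrightarrow> G loss w differentiable (at V within gmanifold)"
    and "bdd_above (G_grad_norms loss S1 S2)"
    and "L\<^sub>G = Sup (G_grad_norms loss S1 S2)"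
    and "0 < \<epsilon>" and "\<xi> = \<epsilon> * L\<^sub>G / 2"
    and "K = gcball Vs \<xi>" and "K \<subseteq> S2"
    and "0 < m"
    and "\<And>w. w \<in> S1 \<Longrightarrow> strongly_geodesically_concave_on m (penalized loss Vs \<epsilon> w) S2"
    and "\<And>w. w \<in> S1 \<Longrightarrow> is_arg_max (penalized loss Vs \<epsilon> w) (\<lambda>V. V \<in> S2) (V\<epsilon> w)"
    and "\<And>w. w \<in> S1 \<Longrightarrow> V\<epsilon> w \<in> top_of_set gmanifold interior_of S2"
  shows "\<forall>w\<in>S1.
     (gdist (V\<epsilon> w) Vs \<le> \<epsilon> * L\<^sub>G / 2 \<and> \<epsilon> * L\<^sub>G / 2 = \<xi> \<and> V\<epsilon> w \<in> K) \<and>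
     (\<forall>V\<xi>. is_arg_max (G loss w) (\<lambda>V. V \<in> K) V\<xi> \<longrightarrow>
        gdist (V\<epsilon> w) V\<xi> \<le> (1 + sqrt 2) * \<xi>) \<and>
     ((\<exists>V\<xi>. is_arg_max (G loss w) (\<lambda>V. V \<in> K) V\<xi>) \<and>
      0 \<le> (SUP V\<in>K. G loss w V) - G loss w (V\<epsilon> w) \<and>
      (SUP V\<in>K. G loss w V) - G loss w (V\<epsilon> w) \<le> 2 * \<xi>\<^sup>2 / \<epsilon> \<and>
      2 * \<xi>\<^sup>2 / \<epsilon> = \<xi> * L\<^sub>G)"
proof
  fix w assume w: "w \<in> S1"
  note \<Lambda>s = assms(1) and Vs = assms(2) and r = assms(9) and S2 = assms(11)
    and diff = assms(14)[OF w] and bdd = assms(15) and L = assms(16) and \<epsilon> = assms(17)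
    and \<xi> = assms(18) and K = assms(19) and KS2 = assms(20)
    and argmax = assms(23)[OF w]
  define V where "V = V\<epsilon> w"
  have VsM: "Vs \<in> gmanifold" using \<Lambda>s Vs by (simp add: gmanifold_def)
  have VS2: "V \<in> S2"
    and max: "\<And>W. W \<in> S2 \<Longrightarrow> G loss w W - 1 / \<epsilon> * \<psi> Vs W \<le> G loss w V - 1 / \<epsilon> * \<psi> Vs V"
    using argmax by (auto simp: is_arg_max_linorder V_def penalized_def)
  have VM: "V \<in> gmanifold" using VS2 S2 by (simp add: gcball_def)
  have "gnorm V (ggrad (G loss w) V) \<le> L\<^sub>G"
    unfolding L using bdd w VS2 by (intro cSup_upper) (auto simp: G_grad_norms_def)
  moreover have "gdist V Vs \<le> \<epsilon> * gnorm V (ggrad (G loss w) V) / 2"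
    using VsM VS2 diff[OF VS2] max \<epsilon> unfolding S2 by (rule penalized_maximizer_gdist_le)
  ultimately have dist: "gdist V Vs \<le> \<xi>"
    unfolding \<xi> using \<epsilon> by (smt (verit) divide_right_mono mult_left_mono)
  have comp: "norm (fst V - fst Vs) \<le> gdist V Vs" "bw_dist (snd V) (snd Vs) \<le> gdist V Vs"
    by (simp_all add: gdist_def real_sqrt_sum_squares_ge1 real_sqrt_sum_squares_ge2)
  have \<xi>0: "0 \<le> \<xi>" using dist comp(1) norm_ge_zero[of "fst V - fst Vs"] by linarith
  have VK: "V \<in> K"
    using VM dist comp by (simp add: K gcball_def dist_norm)
  have \<psi>K: "\<psi> Vs W \<le> 2 * \<xi>\<^sup>2" if "W \<in> K" for W
    using gcball_\<psi>_le[OF VsM] that by (simp add: K)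
  have near: "gdist V W \<le> (1 + sqrt 2) * \<xi>" if W: "W \<in> K" for W
  proof -
    have WM: "W \<in> gmanifold" using W K by (simp add: gcball_def)
    have "gdist W Vs \<le> sqrt (2 * \<xi>\<^sup>2)"
      using \<psi>K[OF W] by (simp add: gdist_eq_sqrt_\<psi>)
    then have "gdist Vs W \<le> sqrt 2 * \<xi>"
      using \<xi>0 by (simp add: gdist_commute[OF VsM WM] real_sqrt_mult)
    then show ?thesis
      using gdist_triangle[OF VM VsM WM] dist by (simp add: distrib_right)
  qed
  \<comment> \<open>The form of \<open>r\<close> gives
    \<open>r\<^sup>2 * ?s = (1 - \<gamma>)\<^sup>2 < 1\<close> for positive \<open>?s\<close>.
    Inclusion in \<open>S2\<close> lets \<open>K\<close> be rewritten as a ball of radius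
    \<open>min \<xi> r\<close>, which inherits this bound.\<close>
  have "compact K"
  proof -
    let ?s = "spectral_norm (matrix_inv \<Lambda>s)"
    have "r\<^sup>2 * ?s < 1"
    proof (cases "?s = 0")
      case False
      then have s: "0 < ?s" using spectral_norm_nonneg[of "matrix_inv \<Lambda>s"] by simp
      have "(?s powr (- 1 / 2))\<^sup>2 = ?s powr (- 1)"
        using s by (simp add: power2_eq_square powr_add[symmetric])
      then have "r\<^sup>2 * ?s = (1 - \<gamma>)\<^sup>2"
        using s by (simp add: r power_mult_distrib powr_minus)
      also have "\<dots> < 1"
        using assms(7,8) by (simp add: power_less_one_iff abs_square_less_1)
      finally show ?thesis .
    qed simp
    moreover have "(min \<xi> r)\<^sup>2 \<le> r\<^sup>2"
      using \<xi>0 assms(8) by (intro power_mono) (simp_all add: r)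
    ultimately have "(min \<xi> r)\<^sup>2 * ?s < 1"
      using mult_right_mono[OF _ spectral_norm_nonneg[of "matrix_inv \<Lambda>s"]] by (meson le_less_trans)
    then have "compact (gcball Vs (min \<xi> r))"
      using \<Lambda>s Vs by (intro compact_gcball) simp_all
    moreover have "K = gcball Vs (min \<xi> r)"
      using KS2 unfolding K S2 by (auto simp: gcball_def)
    ultimately show ?thesis by simp
  qed
  moreover have "continuous_on K (G loss w)"
    unfolding continuous_on_eq_continuous_within
  proof
    fix W assume "W \<in> K"
    then have "continuous (at W within gmanifold) (G loss w)"
      using diff KS2 by (blast intro: differentiable_imp_continuous_within)
    moreover have "K \<subseteq> gmanifold" by (auto simp: K gcball_def)
    ultimately show "continuous (at W within K) (G loss w)"
      by (rule continuous_within_subset)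
  qed
  ultimately obtain X where X: "X \<in> K" "\<And>W. W \<in> K \<Longrightarrow> G loss w W \<le> G loss w X"
    using continuous_attains_sup[of K "G loss w"] VK by blast
  have SUP: "(SUP W\<in>K. G loss w W) = G loss w X"
    using X by (intro cSup_eq_maximum) auto
  \<comment> \<open>The constrained maximizer \<open>X\<close> lies in \<open>S2\<close>, so it
    competes in the penalized problem; afterwards the nonnegative penalty at \<open>V\<close> is
    dropped.\<close>
  have "G loss w X - G loss w V \<le> 1 / \<epsilon> * (\<psi> Vs X - \<psi> Vs V)"
    using max[of X] X(1) KS2 by (auto simp: right_diff_distrib)
  also have "\<dots> \<le> 1 / \<epsilon> * (2 * \<xi>\<^sup>2)"
    using \<psi>K[OF X(1)] \<epsilon> by (intro mult_left_mono) (simp_all add: \<psi>_def add_increasing2 diff_le_eq)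
  finally have "G loss w X - G loss w V \<le> 2 * \<xi>\<^sup>2 / \<epsilon>"
    by simp
  moreover have "0 \<le> G loss w X - G loss w V"
    using X(2)[OF VK] by simp
  moreover have "2 * \<xi>\<^sup>2 / \<epsilon> = \<xi> * L\<^sub>G"
    using \<epsilon> by (simp add: \<xi> power2_eq_square)
  moreover have "is_arg_max (G loss w) (\<lambda>V. V \<in> K) X"
    using X by (auto simp: is_arg_max_linorder)
  moreover have "W \<in> K" if "is_arg_max (G loss w) (\<lambda>V. V \<in> K) W" for W
    using that by (simp add: is_arg_max_linorder)
  ultimately show "(gdist (V\<epsilon> w) Vs \<le> \<epsilon> * L\<^sub>G / 2 \<and> \<epsilon> * L\<^sub>G / 2 = \<xi> \<and> V\<epsilon> w \<in> K) \<and>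
     (\<forall>V\<xi>. is_arg_max (G loss w) (\<lambda>V. V \<in> K) V\<xi> \<longrightarrow>
        gdist (V\<epsilon> w) V\<xi> \<le> (1 + sqrt 2) * \<xi>) \<and>
     ((\<exists>V\<xi>. is_arg_max (G loss w) (\<lambda>V. V \<in> K) V\<xi>) \<and>
      0 \<le> (SUP V\<in>K. G loss w V) - G loss w (V\<epsilon> w) \<and>
      (SUP V\<in>K. G loss w V) - G loss w (V\<epsilon> w) \<le> 2 * \<xi>\<^sup>2 / \<epsilon> \<and>
      2 * \<xi>\<^sup>2 / \<epsilon> = \<xi> * L\<^sub>G)"
    unfolding SUP V_def[symmetric] \<xi>[symmetric] using dist VK near by blast
qed

end
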